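(* Let $\mathcal C$ be an $(n,k,d)$ narrow-sense binary BCH code with designed minimum distance $d$ ($d$ odd), put $t_0=d/2$, and let $t$ be an integer with $$t_0<t<\frac{n-\sqrt{n(n-2d)}}{2}.$$ Choose the multiplicity $$m=\left\lfloor\frac{t\,t_0}{t^2-n(t-t_0)}\right\rfloor .$$ Then, for every received word $R\in\mathrm{GF}(2)^n$, the list decoding algorithm for binary BCH codes described in the context, run with these $t$ and $m$, produces all codewords of $\mathcal C$ up to Hamming distance $t$ from $R$.
   Context: **Code.** $\alpha$ is a primitive element of $\mathrm{GF}(q)$, $q$ a power of $2$, $n\le q-1$, $d$ is odd with $2d\le n$. The code $\mathcal C$ is the set of binary polynomials $C(x)=\sum_{i=0}^{n-1}C_ix^i$ with $C(\alpha)=C(\alpha^2)=\dots=C(\alpha^{d-1})=0$; $k$ is its dimension. A received word is a binary polynomial $R(x)=\sum_{i=0}^{n-1}R_ix^i$, with syndromes $S_i=R(\alpha^{i+1})$, $0\le i\le d-2$. **Berlekamp algorithm (re-formulated).** Start with $\Lambda^{(0)}=1$, $B^{(-1)}=x^{-1}$, $L_\Lambda^{(0)}=0$, $L_B^{(-1)}=-1$. For $r=0,2,4,\dots,d-3$: $\Delta^{(r+2)}=\sum_{i=0}^{L_\Lambda^{(r)}}\Lambda_i^{(r)}S_{r-i}$; $\Lambda^{(r+2)}=\Lambda^{(r)}-\Delta^{(r+2)}x^2B^{(r-1)}$; if $\Delta^{(r+2)}\neq0$ and $2L^{(r)}_\Lambda\le r$ then $B^{(r+1)}=(\Delta^{(r+2)})^{-1}\Lambda^{(r)}$,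 $L_\Lambda^{(r+2)}=L_B^{(r-1)}+2$, $L_B^{(r+1)}=L_\Lambda^{(r)}$; otherwise $B^{(r+1)}=x^2B^{(r-1)}$, $L_B^{(r+1)}=L_B^{(r-1)}+2$, $L_\Lambda^{(r+2)}=L_\Lambda^{(r)}$. The output is the final $\Lambda(x),B(x),L_\Lambda,L_B$; put $L_{x^2B}=L_B+2$ and $w=L_\Lambda-L_{x^2B}$. **Interpolation notions.** A polynomial $Q(x,y)$ over $\mathrm{GF}(q)$ of $y$-degree at most $P_y$ passes through $(a,c)$, $c\in \mathrm{GF}(q)$, with multiplicity $m$ if $Q(x+a,y+c)$ has no monomial $x^uy^v$ with $u+v<m$; it passes through $(a,\infty)$ with multiplicity $m$ if $y^{P_y}Q(x,1/y)$ passes through $(a,0)$ with multiplicity $m$. The $(2,w)$-weighted degree of $Q$ is the maximum of $2u+wv$ over its monomials $x^uy^v$. **List decoding algorithm** with parameters $t$, $m$, $P_y=\left\lfloor\frac{tm+0.25}{t-t_0}\right\rfloor$: 1. Compute the syndromes of $R$. 2. Run the Berlekamp algorithm. If $L_\Lambda>t$, declare failure (empty list). 3. For $0\le i\le n-1$ put $y_i=-\Lambda(\alpha^{-i})/(\alpha^{-2i}B(\alpha^{-i}))$, with $y_i=\infty$ if $B(\alpha^{-i})=0$. 4. If $L_{x^2B}>t$: if $\Lambda(x)$ has precisely $L_\Lambda$ distinct roots in $\{\alpha^{-i}\}_{i=0}^{n-1}$, return the corresponding unique codeword (flip the bits $R_i$ with $\Lambda(\alpha^{-i})=0$); otherwise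 declare failure. Stop. 5. Compute a nonzero $Q(x,y)$ of $y$-degree at most $P_y$ and of minimum $(2,w)$-weighted degree passing through all $(\alpha^{-2i},y_i)$, $0\le i\le n-1$, each with multiplicity $m$. 6. Rational factorization: starting from $Q^{(0)}=Q$, recursively, for each root $s\in \mathrm{GF}(q)$ of $Q^{(i)}(0,y)$, take $s$ as the coefficient $s_i$ and set $Q^{(i+1)}(x,y)=Q^{(i)}(x,s+xy)/x^a$, with $x^a$ the largest power of $x$ dividing $Q^{(i)}(x,s+xy)$. Collect all resulting $s(x)=\sum_{i<L_s}s_ix^i$, $L_s=t-L_{x^2B}+1+2(t-L_\Lambda)$. 7. For each $s(x)$: apply the Berlekamp-Massey algorithm (minimum-length linear feedback shift register synthesis) to the $2(t-L_\Lambda)$ terms of $s(x)$ starting with $s_{t-L_{x^2B}+1}$ to obtain $\lambda(x)$ with $\lambda(0)=1$; compute $b(x)=s(x)\lambda(x)\bmod x^{t-L_{x^2B}+1}$; form $\Lambda'(x)=\lambda(x^2)\Lambda(x)+b(x^2)\,x^2B(x)$; determine its distinct roots in $\{\alpha^{-i}\}_{i=0}^{n-1}$; if their number equals $\deg\Lambda'$, flip the bits $R_i$ with $\Lambda'(\alpha^{-i})=0$. 8. Return the list of resulting words that are codewords within distance $t$ from $R$. *)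

theory Defs
  imports
    Complex_Main
    "HOL-Library.Z2"
    "HOL-Library.Cardinality"
    "HOL-Computational_Algebra.Polynomial"
begin

text \<open>
  A word of length \<open>n\<close> over $GF(2)$ is a polynomial over \<^typ>\<open>bit\<close> of degree less than \<open>n\<close>;
  it is evaluated at elements of the extension field \<open>'a\<close> through the embedding \<^const>\<open>of_bit\<close>.
\<close>

definition binary_words :: "nat \<Rightarrow> bit poly set" where
  "binary_words n = {R. degree R < n}"

definition word_eval :: "bit poly \<Rightarrow> 'a::field \<Rightarrow> 'a" where
  "word_eval R z = poly (map_poly of_bit R) z"

definition hamming_dist :: "bit poly \<Rightarrow> bit poly \<Rightarrow> nat" where
  "hamming_dist C R = card {i. coeff C i \<noteq> coeff R i}"

definition primitive_element :: "'a::field \<Rightarrow> bool" where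
  "primitive_element \<alpha> \<longleftrightarrow> range (\<lambda>i::nat. \<alpha> ^ i) = UNIV - {0}"

definition bch_code :: "'a::field \<Rightarrow> nat \<Rightarrow> nat \<Rightarrow> bit poly set" where
  "bch_code \<alpha> n d = {C \<in> binary_words n. \<forall>j\<in>{1..d - 1}. word_eval C (\<alpha> ^ j) = 0}"

definition code_dim :: "bit poly set \<Rightarrow> nat" where
  "code_dim \<C> = vector_space.dim (smult :: bit \<Rightarrow> bit poly \<Rightarrow> bit poly) \<C>"

definition syndrome :: "'a::field \<Rightarrow> bit poly \<Rightarrow> nat \<Rightarrow> 'a" where
  "syndrome \<alpha> R i = word_eval R (\<alpha> ^ (i + 1))"

definition locator_roots :: "'a::field \<Rightarrow> nat \<Rightarrow> 'a poly \<Rightarrow> 'a set" where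
  "locator_roots \<alpha> n p = {z \<in> (\<lambda>i. inverse \<alpha> ^ i) ` {..<n}. poly p z = 0}"

definition flip_bits :: "'a::field \<Rightarrow> nat \<Rightarrow> bit poly \<Rightarrow> 'a poly \<Rightarrow> bit poly" where
  "flip_bits \<alpha> n R p = R + (\<Sum>i | i < n \<and> poly p (inverse \<alpha> ^ i) = 0. monom 1 i)"

text \<open>
  The state is $(\Lambda, x^2 B, L_\Lambda, L_{x^2B})$. The initial value $B^{(-1)} = x^{-1}$ with
  $L_B^{(-1)} = -1$ is not a polynomial, but $B$ is only ever used through $x^2 B$, which starts
  as $x$ with $L_{x^2 B} = L_B + 2 = 1$. Throughout $L_\Lambda + L_{x^2B} = r + 1$ and
  $L_{x^2B} \ge 1$, so \<open>r - i\<close> below is never truncated.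
\<close>

type_synonym 'a berlekamp_state = "'a poly \<times> 'a poly \<times> nat \<times> nat"

definition berlekamp_step ::
  "(nat \<Rightarrow> 'a::field) \<Rightarrow> nat \<Rightarrow> 'a berlekamp_state \<Rightarrow> 'a berlekamp_state" where
  "berlekamp_step S r = (\<lambda>(\<Lambda>, xxB, L\<^sub>\<Lambda>, L\<^sub>x\<^sub>x\<^sub>B).
     let \<Delta> = (\<Sum>i\<le>L\<^sub>\<Lambda>. coeff \<Lambda> i * S (r - i));
         \<Lambda>' = \<Lambda> - smult \<Delta> xxB
     in if \<Delta> \<noteq> 0 \<and> 2 * L\<^sub>\<Lambda> \<le> r
        then (\<Lambda>', monom 1 2 * smult (inverse \<Delta>) \<Lambda>, L\<^sub>x\<^sub>x\<^sub>B, L\<^sub>\<Lambda> + 2)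
        else (\<Lambda>', monom 1 2 * xxB, L\<^sub>\<Lambda>, L\<^sub>x\<^sub>x\<^sub>B + 2))"

text \<open>State after the steps $r = 0, 2, \dots, 2(j-1)$.\<close>

primrec berlekamp :: "(nat \<Rightarrow> 'a::field) \<Rightarrow> nat \<Rightarrow> 'a berlekamp_state" where
  "berlekamp S 0 = (1, [:0, 1:], 0, 1)"
| "berlekamp S (Suc j) = berlekamp_step S (2 * j) (berlekamp S j)"

text \<open>
  Massey's form of the algorithm, run on $s_0,\dots,s_{N-1}$. The state is $(C, B, L, b, e)$:
  current connection polynomial, connection polynomial before the last length change, current
  length, discrepancy at the last length change, and number of steps since then.
\<close>

primrec berlekamp_massey ::
  "(nat \<Rightarrow> 'a::field) \<Rightarrow> nat \<Rightarrow> 'a poly \<times> 'a poly \<times> nat \<times> 'a \<times> nat" where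
  "berlekamp_massey s 0 = (1, 1, 0, 1, 1)"
| "berlekamp_massey s (Suc N) =
     (case berlekamp_massey s N of (C, B, L, b, e) \<Rightarrow>
        let \<delta> = s N + (\<Sum>i=1..L. coeff C i * s (N - i));
            C' = C - smult (\<delta> / b) (monom 1 e * B)
        in if \<delta> = 0 then (C, B, L, b, e + 1)
           else if 2 * L > N then (C', B, L, b, e + 1)
           else (C', C, N + 1 - L, \<delta>, 1))"

definition lfsr_synthesis :: "(nat \<Rightarrow> 'a::field) \<Rightarrow> nat \<Rightarrow> 'a poly" where
  "lfsr_synthesis s N = fst (berlekamp_massey s N)"

text \<open>
  $Q(x,y)$ is a polynomial in \<open>y\<close> with coefficients in \<open>'a[x]\<close>: the coefficient of $x^u y^v$ is
  \<open>coeff (coeff Q v) u\<close>, and the \<open>y\<close>-degree is \<^term>\<open>degree Q\<close>.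
\<close>

definition taylor_shift :: "'a::field \<Rightarrow> 'a \<Rightarrow> 'a poly poly \<Rightarrow> 'a poly poly" where
  "taylor_shift a c Q = map_poly (\<lambda>p. pcompose p [:a, 1:]) (pcompose Q [:[:c:], 1:])"

text \<open>$y^P\, Q(x, 1/y)$ for $Q$ of \<open>y\<close>-degree at most $P$.\<close>

definition y_reversal :: "nat \<Rightarrow> 'a::field poly poly \<Rightarrow> 'a poly poly" where
  "y_reversal P Q = (\<Sum>v\<le>P. monom (coeff Q (P - v)) v)"

definition vanishes_at :: "'a::field poly poly \<Rightarrow> 'a \<Rightarrow> 'a \<Rightarrow> nat \<Rightarrow> bool" where
  "vanishes_at Q a c m \<longleftrightarrow> (\<forall>u v. u + v < m \<longrightarrow> coeff (coeff (taylor_shift a c Q) v) u = 0)"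

text \<open>The ordinate $\infty$ is \<^const>\<open>None\<close>.\<close>

fun passes_through ::
  "nat \<Rightarrow> 'a::field poly poly \<Rightarrow> 'a \<times> 'a option \<Rightarrow> nat \<Rightarrow> bool" where
  "passes_through P Q (a, Some c) m \<longleftrightarrow> vanishes_at Q a c m"
| "passes_through P Q (a, None) m \<longleftrightarrow> vanishes_at (y_reversal P Q) a 0 m"

text \<open>Meaningful for $Q \ne 0$ only. The weight \<open>w\<close> may be negative.\<close>

definition weighted_degree :: "int \<Rightarrow> 'a::field poly poly \<Rightarrow> int" where
  "weighted_degree w Q = Max {2 * int u + w * int v | u v. coeff (coeff Q v) u \<noteq> 0}"

definition interpolates :: "nat \<Rightarrow> nat \<Rightarrow> ('a \<times> 'a option) set \<Rightarrow> 'a::field poly poly \<Rightarrow> bool" where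
  "interpolates P m pts Q \<longleftrightarrow> Q \<noteq> 0 \<and> degree Q \<le> P \<and> (\<forall>pt\<in>pts. passes_through P Q pt m)"

definition minimal_interpolant ::
  "nat \<Rightarrow> nat \<Rightarrow> int \<Rightarrow> ('a \<times> 'a option) set \<Rightarrow> 'a::field poly poly \<Rightarrow> bool" where
  "minimal_interpolant P m w pts Q \<longleftrightarrow> interpolates P m pts Q \<and>
     (\<forall>Q'. interpolates P m pts Q' \<longrightarrow> weighted_degree w Q \<le> weighted_degree w Q')"

definition strip_x :: "'a::field poly poly \<Rightarrow> 'a poly poly" where
  "strip_x Q = Q div [:monom 1 (GREATEST a. [:monom 1 a:] dvd Q):]"

text \<open>
  $Q(x, s + xy) / x^a$ with the largest possible $a$, and the set of all polynomials
  $\sum_{i<L} s_i x^i$ whose coefficients are selected by the recursion.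
\<close>

definition factor_step :: "'a::field \<Rightarrow> 'a poly poly \<Rightarrow> 'a poly poly" where
  "factor_step s Q = strip_x (pcompose Q [:[:s:], [:0, 1:]:])"

primrec rational_factors :: "nat \<Rightarrow> 'a::field poly poly \<Rightarrow> 'a poly set" where
  "rational_factors 0 Q = {0}"
| "rational_factors (Suc L) Q =
     (\<Union>s \<in> {s. poly (map_poly (\<lambda>p. poly p 0) Q) s = 0}.
        pCons s ` rational_factors L (factor_step s Q))"

text \<open>Interpolation points $(\alpha^{-2i}, y_i)$; \<open>xxB\<close> is $x^2B(x)$ and $\alpha \ne 0$, so
  $B(\alpha^{-i}) = 0$ iff $x^2B(x)$ vanishes at $\alpha^{-i}$.\<close>

definition interpolation_point :: "'a::field \<Rightarrow> 'a poly \<Rightarrow> 'a poly \<Rightarrow> nat \<Rightarrow> 'a \<times> 'a option" where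
  "interpolation_point \<alpha> \<Lambda> xxB i =
     (let z = inverse \<alpha> ^ i
      in (z ^ 2, if poly xxB z = 0 then None else Some (- poly \<Lambda> z / poly xxB z)))"

definition y_degree_bound :: "nat \<Rightarrow> nat \<Rightarrow> nat \<Rightarrow> nat" where
  "y_degree_bound d t m =
     nat \<lfloor>(real t * real m + 1 / 4) / (real t - real d / 2)\<rfloor>"

text \<open>The candidate locator $\Lambda'(x) = \lambda(x^2)\Lambda(x) + b(x^2)\,x^2B(x)$; here $D = t - L_{x^2B}$ and
  $N = 2(t - L_\Lambda)$.\<close>

definition locator_from_series ::
  "'a::field poly \<Rightarrow> 'a poly \<Rightarrow> nat \<Rightarrow> nat \<Rightarrow> 'a poly \<Rightarrow> 'a poly" where
  "locator_from_series \<Lambda> xxB D N s =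
     (let lam = lfsr_synthesis (\<lambda>j. coeff s (D + 1 + j)) N;
          b = (s * lam) mod monom 1 (D + 1)
      in pcompose lam (monom 1 2) * \<Lambda> + pcompose b (monom 1 2) * xxB)"

text \<open>
  \<open>out\<close> is a possible output on the received word \<open>R\<close>. This is a relation since the minimal
  interpolant need not be unique.
\<close>

definition list_decoder_output ::
  "'a::field \<Rightarrow> nat \<Rightarrow> nat \<Rightarrow> nat \<Rightarrow> nat \<Rightarrow> bit poly \<Rightarrow> bit poly set \<Rightarrow> bool" where
  "list_decoder_output \<alpha> n d t m R out \<longleftrightarrow>
     (case berlekamp (syndrome \<alpha> R) ((d - 1) div 2) of (\<Lambda>, xxB, L\<^sub>\<Lambda>, L\<^sub>x\<^sub>x\<^sub>B) \<Rightarrow>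
        if L\<^sub>\<Lambda> > t then out = {}
        else if L\<^sub>x\<^sub>x\<^sub>B > t then
          out = (if card (locator_roots \<alpha> n \<Lambda>) = L\<^sub>\<Lambda> then {flip_bits \<alpha> n R \<Lambda>} else {})
        else
          (\<exists>Q. minimal_interpolant (y_degree_bound d t m) m (int L\<^sub>\<Lambda> - int L\<^sub>x\<^sub>x\<^sub>B)
                 (interpolation_point \<alpha> \<Lambda> xxB ` {..<n}) Q \<and>
               (let D = t - L\<^sub>x\<^sub>x\<^sub>B;
                    N = 2 * (t - L\<^sub>\<Lambda>);
                    locators = locator_from_series \<Lambda> xxB D N ` rational_factors (D + 1 + N) Q;
                    words = {flip_bits \<alpha> n R p | p.
                               p \<in> locators \<and> card (locator_roots \<alpha> n p) = degree p}
                in out = {C \<in> words. C \<in> bch_code \<alpha> n d \<and> hamming_dist C R \<le> t})))"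

end

theory Submission
  imports Defs "HOL-Computational_Algebra.Polynomial_FPS"
begin

text \<open>
  The syndrome series of \<open>R\<close> is the logarithmic derivative of a polynomial, so the locators of words
  with prescribed syndromes are governed by a linear condition on odd coefficients, which cuts out a
  free module of rank two over the polynomials in \<open>x\<^sup>2\<close>; the Berlekamp algorithm computes a
  degree-reduced basis \<open>\<Lambda>, x\<^sup>2B\<close> of it. The error locator of a codeword at distance \<open>\<tau> \<le> t\<close> is therefore
  \<open>\<lambda>(x\<^sup>2) \<Lambda> + b(x\<^sup>2) x\<^sup>2B\<close> with controlled degrees, and the rational function \<open>b/\<lambda>\<close> passes through the
  interpolation points at the \<open>\<tau>\<close> error positions. With the given \<open>m\<close> and \<open>P\<close>, counting monomials
  against constraints shows that the minimal interpolant \<open>Q\<close> has such a small weighted degree that the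
  numerator of \<open>Q(x, b/\<lambda>)\<close> has more zeros than its degree allows, so it vanishes. Hence the
  series of \<open>b/\<lambda>\<close> is among the rational factors, and shift register synthesis recovers \<open>\<lambda>\<close> and \<open>b\<close>;
  these are coprime because the locator has simple roots.
\<close>

section \<open>Power series modulo powers of x\<close>

lemma fps_X_power_dvd_iff:
  fixes f :: "'a::field fps"
  shows "fps_X ^ N dvd f \<longleftrightarrow> (\<forall>j<N. fps_nth f j = 0)"
proof
  assume "fps_X ^ N dvd f"
  then obtain g where "f = fps_X ^ N * g" ..
  thus "\<forall>j<N. fps_nth f j = 0" by (simp add: fps_X_power_mult_nth)
next
  assume *: "\<forall>j<N. fps_nth f j = 0"
  have "f = fps_X ^ N * fps_shift N f"
    by (rule fps_ext) (use * in \<open>simp add: fps_X_power_mult_nth\<close>)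
  thus "fps_X ^ N dvd f" by (metis dvd_triv_left)
qed

text \<open>Turns the discrepancy sums of both shift-register algorithms into coefficients of
  products of power series.\<close>

lemma fps_nth_mult_le_degree:
  fixes C :: "'a::field poly"
  assumes "degree C \<le> L" "L \<le> N"
  shows "fps_nth (fps_of_poly C * U) N = (\<Sum>i\<le>L. coeff C i * fps_nth U (N - i))"
proof -
  have "(\<Sum>i=0..N. coeff C i * fps_nth U (N - i)) = (\<Sum>i\<le>L. coeff C i * fps_nth U (N - i))"
    by (rule sum.mono_neutral_right) (use assms in \<open>auto simp: coeff_eq_0\<close>)
  thus ?thesis by (simp add: fps_mult_nth)
qed

subsection \<open>Linear feedback shift register synthesis\<close>

text \<open>
  Each connection polynomial is paired with a numerator. With \<open>G = x\<^sup>e B\<close> paired with \<open>PB\<close>, the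
  invariant holds from the start: the initial state has \<open>G = x\<close> and \<open>PB = -1\<close>.
\<close>

definition massey_invariant where
  "massey_invariant U N C B L b e \<longleftrightarrow>
     coeff C 0 = 1 \<and> degree C \<le> L \<and> L \<le> N \<and> b \<noteq> 0 \<and> 0 < e \<and>
     degree (monom 1 e * B) \<le> N + 1 - L \<and>
     (\<exists>P PB. (\<forall>j\<ge>L. coeff P j = 0) \<and> (\<forall>j>N - L. coeff PB j = 0) \<and>
       fps_X ^ N dvd fps_of_poly C * U - fps_of_poly P \<and>
       fps_X ^ (N + 1) dvd fps_of_poly (monom 1 e * B) * U - fps_of_poly (PB + monom b N))"

lemma berlekamp_massey_invariant:
  fixes s :: "nat \<Rightarrow> 'a::field"
  assumes "berlekamp_massey s N = (C, B, L, b, e)"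
  shows "massey_invariant (Abs_fps s) N C B L b e"
  using assms
proof (induction N arbitrary: C B L b e)
  case 0
  have "degree (monom (1::'a) 1) \<le> 1" by (rule degree_monom_le)
  moreover have "fps_X dvd fps_of_poly (monom 1 1) * Abs_fps s - fps_of_poly (-1 + monom (1::'a) 0)"
    by (simp add: fps_of_poly_monom one_pCons monom_0)
  ultimately show ?case using 0
    unfolding massey_invariant_def by (intro conjI exI[of _ 0] exI[of _ "-1"]) auto
next
  case (Suc N)
  let ?U = "Abs_fps s"
  obtain C0 B0 L0 b0 e0 where st: "berlekamp_massey s N = (C0, B0, L0, b0, e0)"
    by (cases "berlekamp_massey s N") auto
  define \<delta> where "\<delta> = s N + (\<Sum>i=1..L0. coeff C0 i * s (N - i))"
  define G where "G = monom 1 e0 * B0"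
  define C' where "C' = C0 - smult (\<delta> / b0) G"
  from Suc.IH[OF st] obtain P PB where
    inv: "coeff C0 0 = 1" "degree C0 \<le> L0" "L0 \<le> N" "b0 \<noteq> 0" "0 < e0"
      "degree G \<le> N + 1 - L0"
    and P: "\<And>j. j \<ge> L0 \<Longrightarrow> coeff P j = 0" and PB: "\<And>j. j > N - L0 \<Longrightarrow> coeff PB j = 0"
    and dC: "fps_X ^ N dvd fps_of_poly C0 * ?U - fps_of_poly P"
    and dG: "fps_X ^ (N + 1) dvd fps_of_poly G * ?U - fps_of_poly (PB + monom b0 N)"
    unfolding massey_invariant_def G_def by auto
  have step: "berlekamp_massey s (Suc N) =
     (if \<delta> = 0 then (C0, B0, L0, b0, e0 + 1)
      else if 2 * L0 > N then (C', B0, L0, b0, e0 + 1) else (C', C0, N + 1 - L0, \<delta>, 1))"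
    by (simp add: st \<delta>_def C'_def G_def Let_def)
  have "{..L0} = insert 0 {1..L0}" by auto
  hence "(\<Sum>i\<le>L0. coeff C0 i * fps_nth ?U (N - i)) = \<delta>"
    by (simp add: \<delta>_def inv)
  hence nth: "fps_nth (fps_of_poly C0 * ?U) N = \<delta>"
    using fps_nth_mult_le_degree[OF inv(2,3), of ?U] by simp
  \<comment> \<open>\<open>P\<close> has no coefficient at \<open>N\<close> because
    \<open>L0 \<le> N\<close>, so the product departs from \<open>P\<close> there by exactly the
    discrepancy.\<close>
  have dC': "fps_X ^ (N + 1) dvd fps_of_poly C0 * ?U - fps_of_poly (P + monom \<delta> N)"
    using dC P[of N] inv nth unfolding fps_X_power_dvd_iff by (auto simp: less_Suc_eq)
  have dGx: "fps_X ^ (N + 2) dvd fps_of_poly (monom 1 1 * G) * ?U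
      - fps_of_poly (monom 1 1 * PB + monom b0 (N + 1))"
  proof -
    have "fps_of_poly (monom 1 1 * G) * ?U - fps_of_poly (monom 1 1 * PB + monom b0 (N + 1))
        = fps_X * (fps_of_poly G * ?U - fps_of_poly (PB + monom b0 N))"
      by (simp add: fps_of_poly_simps fps_of_poly_monom algebra_simps)
    thus ?thesis using dG by (simp add: mult_dvd_mono)
  qed
  have Gx: "monom 1 (e0 + 1) * B0 = monom 1 1 * G"
    by (simp add: G_def mult_monom flip: mult.assoc)
  have degGx: "degree (monom 1 1 * G) \<le> N + 2 - L0"
    using inv degree_mult_le[of "monom 1 1" G] degree_monom_le[of "1::'a" 1] by linarith
  have PBx: "coeff (monom 1 1 * PB) j = 0" if "j > N + 1 - L0" for j
    using that PB[of "j - 1"] inv(3) by (auto simp: coeff_monom_mult)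
  have G0: "coeff G 0 = 0" using inv by (simp add: G_def coeff_monom_mult)
  \<comment> \<open>The numerators are combined in the same way as the connection polynomials; the
    monomials at \<open>x^N\<close> cancel.\<close>
  define P' where "P' = P - smult (\<delta> / b0) PB"
  have dC'': "fps_X ^ Suc N dvd fps_of_poly C' * ?U - fps_of_poly P'"
  proof -
    have "fps_of_poly (smult (\<delta> / b0) (monom b0 N)) = fps_of_poly (monom \<delta> N)"
      using inv by (simp add: smult_monom)
    hence "fps_of_poly C' * ?U - fps_of_poly P' =
       (fps_of_poly C0 * ?U - fps_of_poly (P + monom \<delta> N)) -
       fps_const (\<delta> / b0) * (fps_of_poly G * ?U - fps_of_poly (PB + monom b0 N))"
      by (simp add: C'_def P'_def fps_of_poly_simps algebra_simps)
    thus ?thesis using dC' dG by (metis Suc_eq_plus1 dvd_diff dvd_mult)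
  qed
  have C'0: "coeff C' 0 = 1" using inv G0 by (simp add: C'_def)
  have degC': "degree C' \<le> max L0 (N + 1 - L0)"
    unfolding C'_def using inv by (intro degree_diff_le order.trans[OF degree_smult_le]) auto
  consider "\<delta> = 0" | "\<delta> \<noteq> 0" "2 * L0 > N" | "\<delta> \<noteq> 0" "2 * L0 \<le> N" by linarith
  thus ?case
  proof cases
    case 1
    with step Suc.prems have eq: "C = C0" "B = B0" "L = L0" "b = b0" "e = e0 + 1" by auto
    have "fps_X ^ Suc N dvd fps_of_poly C0 * ?U - fps_of_poly P"
      using dC' 1 by simp
    thus ?thesis unfolding massey_invariant_def eq Gx
      using inv P PBx dGx degGx
      by (intro conjI exI[of _ P] exI[of _ "monom 1 1 * PB"]) (auto simp: Suc_diff_le)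
  next
    case 2
    with step Suc.prems have eq: "C = C'" "B = B0" "L = L0" "b = b0" "e = e0 + 1" by auto
    have "coeff P' j = 0" if "j \<ge> L0" for j
      using that 2 P PB[of j] by (simp add: P'_def)
    thus ?thesis unfolding massey_invariant_def eq Gx
      using inv P PBx dGx degGx dC'' C'0 degC' 2
      by (intro conjI exI[of _ P'] exI[of _ "monom 1 1 * PB"]) (auto simp: Suc_diff_le)
  next
    case 3
    with step Suc.prems have eq: "C = C'" "B = C0" "L = N + 1 - L0" "b = \<delta>" "e = 1" by auto
    have 1: "coeff P' j = 0" if "j \<ge> N + 1 - L0" for j
      using that 3 P[of j] PB[of j] inv(3) by (simp add: P'_def)
    \<comment> \<open>At a length change the old connection polynomial, shifted by x, becomes the
      second pair, with its discrepancy as the new \<open>b\<close>.\<close>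
    have 2: "fps_X ^ (Suc N + 1) dvd fps_of_poly (monom 1 1 * C0) * ?U
        - fps_of_poly (monom 1 1 * P + monom \<delta> (Suc N))"
    proof -
      have "fps_of_poly (monom 1 1 * C0) * ?U - fps_of_poly (monom 1 1 * P + monom \<delta> (Suc N))
        = fps_X * (fps_of_poly C0 * ?U - fps_of_poly (P + monom \<delta> N))"
        by (simp add: fps_of_poly_simps fps_of_poly_monom algebra_simps)
      thus ?thesis using dC' by (simp add: mult_dvd_mono)
    qed
    have 3: "degree (monom 1 1 * C0) \<le> L0 + 1"
      using inv degree_mult_le[of "monom 1 1" C0] degree_monom_le[of "1::'a" 1] by linarith
    have 4: "coeff (monom 1 1 * P) j = 0" if "j > L0" for j
      using that P[of "j - 1"] by (auto simp: coeff_monom_mult)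
    have 5: "N + 1 - L0 \<le> Suc N" "Suc N + 1 - (N + 1 - L0) = L0 + 1" "Suc N - (N + 1 - L0) = L0"
      using inv(3) by auto
    have 6: "degree C' \<le> N + 1 - L0" using degC' \<open>2 * L0 \<le> N\<close> by auto
    show ?thesis unfolding massey_invariant_def eq 5
      using 1 2 3 4 5(1) 6 C'0 \<open>\<delta> \<noteq> 0\<close> dC''
      by (intro conjI exI[of _ P'] exI[of _ "monom 1 1 * P"]) auto
  qed
qed

text \<open>
  Cross-multiplying with both pairs of the invariant: the product with the second pair is nonzero
  at \<open>x^N\<close>, which bounds the synthesized length by \<open>l\<close>; the product with the first pair then vanishes.
\<close>

lemma lfsr_synthesis_cofactor:
  fixes lam c :: "'a::field poly"
  assumes lam: "degree lam \<le> l" "coeff lam 0 = 1" and c: "\<And>j. j \<ge> l \<Longrightarrow> coeff c j = 0"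
    and N: "2 * l \<le> N"
    and dvd: "fps_X ^ N dvd fps_of_poly lam * Abs_fps s - fps_of_poly c"
  shows "\<exists>\<kappa>. lam = lfsr_synthesis s N * \<kappa> \<and> \<kappa> dvd c"
proof -
  let ?U = "Abs_fps s"
  obtain C B L b e where st: "berlekamp_massey s N = (C, B, L, b, e)"
    by (cases "berlekamp_massey s N") auto
  define G where "G = monom 1 e * B"
  from berlekamp_massey_invariant[OF st] obtain P PB where
    inv: "coeff C 0 = 1" "degree C \<le> L" "L \<le> N" "b \<noteq> 0" "0 < e"
      "degree G \<le> N + 1 - L"
    and P: "\<And>j. j \<ge> L \<Longrightarrow> coeff P j = 0" and PB: "\<And>j. j > N - L \<Longrightarrow> coeff PB j = 0"
    and dC: "fps_X ^ N dvd fps_of_poly C * ?U - fps_of_poly P"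
    and dG: "fps_X ^ (N + 1) dvd fps_of_poly G * ?U - fps_of_poly (PB + monom b N)"
    unfolding massey_invariant_def G_def by auto
  have degPB: "degree PB \<le> N - L" by (rule degree_le) (use PB in auto)
  \<comment> \<open>The factor x of \<open>G\<close>, due to \<open>0 < e\<close>, supplies the one
    order of precision by which the relations for \<open>lam\<close> and \<open>C\<close> fall short
    of the one for \<open>G\<close>.\<close>
  have XG: "fps_X dvd fps_of_poly G"
    using inv fps_X_power_dvd_iff[of 1 "fps_of_poly G"] by (simp add: G_def coeff_monom_mult)
  have coeff_mult0: "coeff (p * q) k = 0"
    if "\<And>j. j > x \<Longrightarrow> coeff p j = 0" "\<And>j. j \<ge> y \<Longrightarrow> coeff q j = 0" "x + y \<le> k" for p q :: "'a poly" and x y k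
  proof -
    have "coeff p i * coeff q (k - i) = 0" if "i \<le> k" for i
      using that \<open>x + y \<le> k\<close> \<open>\<And>j. j > x \<Longrightarrow> coeff p j = 0\<close>[of i]
        \<open>\<And>j. j \<ge> y \<Longrightarrow> coeff q j = 0\<close>[of "k - i"] by (cases "i > x") auto
    thus ?thesis by (auto simp: coeff_mult intro: sum.neutral)
  qed
  \<comment> \<open>Eliminating \<open>?U\<close> from the relations for \<open>lam\<close> and
    \<open>G\<close> shows that \<open>E\<close> is \<open>- b x^N lam\<close> modulo
    \<open>x^(N + 1)\<close>.\<close>
  define E where "E = lam * PB - G * c"
  have E: "fps_X ^ (N + 1) dvd fps_of_poly (E + monom b N * lam)"
  proof -
    have "fps_X * fps_X ^ N dvd fps_of_poly G * (fps_of_poly lam * ?U - fps_of_poly c)"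
      using XG dvd by (rule mult_dvd_mono)
    moreover have "fps_of_poly (E + monom b N * lam) =
        fps_of_poly G * (fps_of_poly lam * ?U - fps_of_poly c)
        - fps_of_poly lam * (fps_of_poly G * ?U - fps_of_poly (PB + monom b N))"
      by (simp add: E_def fps_of_poly_simps algebra_simps)
    ultimately show ?thesis using dG by (simp add: dvd_diff)
  qed
  have cE: "coeff E j = - coeff (monom b N * lam) j" if "j \<le> N" for j
    using iffD1[OF fps_X_power_dvd_iff E] that by (simp add: add_eq_0_iff2)
  have E_low: "coeff E j = 0" if "j < N" for j
    using cE[of j] that by (simp add: coeff_monom_mult)
  \<comment> \<open>If \<open>l < L\<close>, neither product in \<open>E\<close> reaches
    \<open>x^N\<close>, yet the coefficient of \<open>E\<close> there is \<open>- b\<close>.\<close>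
  have "L \<le> l"
  proof (rule ccontr)
    assume "\<not> L \<le> l"
    hence "coeff (lam * PB) N = 0" using lam inv(3)
      by (intro coeff_mult0[of l _ "N - L + 1"]) (auto simp: coeff_eq_0 PB)
    moreover have "coeff (G * c) N = 0" using \<open>\<not> L \<le> l\<close> inv c
      by (intro coeff_mult0[of "N + 1 - L" _ l]) (auto simp: coeff_eq_0)
    ultimately show False using inv(4) cE[of N] lam by (simp add: E_def coeff_monom_mult)
  qed
  \<comment> \<open>Below \<open>N\<close> elimination of \<open>?U\<close> gives equality; from
    \<open>N\<close> on both products vanish, since
    \<open>L + l \<le> 2 * l \<le> N\<close>.\<close>
  have PC: "lam * P = C * c"
  proof (rule poly_eqI)
    fix j
    show "coeff (lam * P) j = coeff (C * c) j"
    proof (cases "j < N")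
      case True
      have "fps_of_poly (lam * P - C * c) = fps_of_poly C * (fps_of_poly lam * ?U - fps_of_poly c)
          - fps_of_poly lam * (fps_of_poly C * ?U - fps_of_poly P)"
        by (simp add: fps_of_poly_simps algebra_simps)
      hence "fps_X ^ N dvd fps_of_poly (lam * P - C * c)"
        using dvd dC by (simp add: dvd_diff)
      thus ?thesis using True by (auto simp: fps_X_power_dvd_iff)
    next
      case False
      have "coeff (lam * P) j = 0" using lam False \<open>L \<le> l\<close> N P
        by (intro coeff_mult0[of l _ L]) (auto simp: coeff_eq_0)
      moreover have "coeff (C * c) j = 0" using inv False \<open>L \<le> l\<close> N c
        by (intro coeff_mult0[of L _ l]) (auto simp: coeff_eq_0)
      ultimately show ?thesis by simp
    qed
  qed
  \<comment> \<open>Elimination fixes this determinant up to \<open>x^N\<close>, degrees fix it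
    beyond. Being a nonzero monomial, it allows \<open>lam\<close> to be solved for as a multiple of
    \<open>C\<close>.\<close>
  have det: "C * PB - G * P = - monom b N"
  proof (rule poly_eqI)
    fix j
    show "coeff (C * PB - G * P) j = coeff (- monom b N) j"
    proof (cases "j \<le> N")
      case True
      have "fps_X * fps_X ^ N dvd fps_of_poly G * (fps_of_poly C * ?U - fps_of_poly P)"
        using XG dC by (rule mult_dvd_mono)
      moreover have "fps_of_poly (C * PB - G * P + monom b N * C) =
        fps_of_poly G * (fps_of_poly C * ?U - fps_of_poly P)
        - fps_of_poly C * (fps_of_poly G * ?U - fps_of_poly (PB + monom b N))"
        by (simp add: fps_of_poly_simps algebra_simps)
      ultimately have "fps_X ^ (N + 1) dvd fps_of_poly (C * PB - G * P + monom b N * C)"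
        using dG by (simp add: dvd_diff)
      hence "coeff (C * PB - G * P) j + coeff (monom b N * C) j = 0"
        using True by (subst (asm) fps_X_power_dvd_iff) (auto dest!: spec[of _ j])
      thus ?thesis using True inv by (auto simp: coeff_monom_mult add_eq_0_iff2 split: if_splits)
    next
      case False
      have "coeff (C * PB) j = 0" using inv False PB
        by (intro coeff_mult0[of L _ "N - L + 1"]) (auto simp: coeff_eq_0)
      moreover have "coeff (G * P) j = 0" using inv False P
        by (intro coeff_mult0[of "N + 1 - L" _ L]) (auto simp: coeff_eq_0)
      ultimately show ?thesis using False by simp
    qed
  qed
  have "monom 1 N dvd E" using E_low by (auto simp: monom_1_dvd_iff')
  then obtain K where K: "E = monom 1 N * K" by (auto elim: dvdE)
  define \<kappa> where "\<kappa> = smult (- 1 / b) K"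
  have "monom 1 N * (C * K) = C * E" by (simp add: K)
  also have "\<dots> = lam * (C * PB) - G * (C * c)" by (simp add: E_def algebra_simps)
  also have "\<dots> = lam * (C * PB - G * P)" by (simp add: PC[symmetric] algebra_simps)
  also have "\<dots> = monom 1 N * (smult (-b) lam)"
    by (simp add: det smult_monom mult.commute[of lam] flip: mult_smult_left)
  finally have "C * K = smult (- b) lam"
    by (metis monom_eq_0_iff mult_left_cancel zero_neq_one)
  hence lam_eq: "lam = C * \<kappa>" using inv(4) by (simp add: \<kappa>_def)
  have "C * (\<kappa> * P) = C * c" using PC by (simp add: lam_eq mult.assoc)
  moreover have "C \<noteq> 0" using inv(1) by auto
  ultimately have "\<kappa> * P = c" by simp
  moreover have "lfsr_synthesis s N = C" by (simp add: lfsr_synthesis_def st)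
  ultimately show ?thesis using lam_eq by (metis dvd_triv_left)
qed

subsection \<open>Rational factorization\<close>

definition eval_fps2 :: "'a::field poly poly \<Rightarrow> 'a fps \<Rightarrow> 'a fps" where
  "eval_fps2 Q f = poly (map_poly fps_of_poly Q) f"

lemma eval_fps2_0 [simp]: "eval_fps2 0 f = 0"
  by (simp add: eval_fps2_def)

lemma eval_fps2_pCons [simp]: "eval_fps2 (pCons p Q) f = fps_of_poly p + f * eval_fps2 Q f"
  by (simp add: eval_fps2_def map_poly_pCons)

lemma eval_fps2_add: "eval_fps2 (P + Q) f = eval_fps2 P f + eval_fps2 Q f"
  by (induction P Q rule: poly_induct2) (simp_all add: fps_of_poly_add algebra_simps)

lemma eval_fps2_smult: "eval_fps2 (smult p Q) f = fps_of_poly p * eval_fps2 Q f"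
  by (induction Q) (simp_all add: fps_of_poly_mult algebra_simps)

lemma eval_fps2_mult: "eval_fps2 (P * Q) f = eval_fps2 P f * eval_fps2 Q f"
  by (induction P) (simp_all add: eval_fps2_add eval_fps2_smult algebra_simps)

lemma eval_fps2_pcompose: "eval_fps2 (pcompose P Q) f = eval_fps2 P (eval_fps2 Q f)"
  by (induction P) (simp_all add: pcompose_pCons eval_fps2_add eval_fps2_mult)

lemma eval_fps2_altdef:
  assumes "degree Q \<le> P"
  shows "eval_fps2 Q f = (\<Sum>v\<le>P. fps_of_poly (coeff Q v) * f ^ v)"
proof -
  have "degree (map_poly fps_of_poly Q) \<le> P"
    using assms by (intro degree_le) (auto simp: coeff_map_poly coeff_eq_0)
  hence "(\<Sum>v\<le>degree (map_poly fps_of_poly Q). coeff (map_poly fps_of_poly Q) v * f ^ v)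
    = (\<Sum>v\<le>P. coeff (map_poly fps_of_poly Q) v * f ^ v)"
    by (intro sum.mono_neutral_left) (auto intro: le_degree)
  thus ?thesis by (simp add: eval_fps2_def poly_altdef coeff_map_poly)
qed

text \<open>Shows that the constant coefficient of a series root is among the choices that the
  recursion makes.\<close>

lemma fps_nth_eval_fps2_0:
  "fps_nth (eval_fps2 Q f) 0 = poly (map_poly (\<lambda>p. poly p 0) Q) (fps_nth f 0)"
  by (induction Q) (simp_all add: map_poly_pCons poly_0_coeff_0)

text \<open>The greatest exponent exists: a power of x dividing \<open>Q\<close> divides a nonzero
  coefficient of \<open>Q\<close>, whose degree bounds it.\<close>

lemma strip_x_eq:
  assumes "Q \<noteq> 0"
  obtains a where "Q = [:monom 1 a:] * strip_x Q"
proof -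
  let ?P = "\<lambda>a. [:monom 1 a:] dvd Q"
  obtain v where v: "coeff Q v \<noteq> 0" using assms by (auto simp: poly_eq_iff)
  have "a \<le> degree (coeff Q v)" if "?P a" for a
  proof -
    have "monom 1 a dvd coeff Q v" using that by (auto simp: const_poly_dvd_iff)
    from dvd_imp_degree_le[OF this v] show ?thesis by (simp add: degree_monom_eq)
  qed
  moreover have "?P 0" by (simp add: monom_0 flip: one_pCons)
  ultimately have "?P (GREATEST a. ?P a)" by (rule GreatestI_nat[rotated 1])
  hence "Q = [:monom 1 (GREATEST a. ?P a):] * strip_x Q"
    unfolding strip_x_def by (rule dvd_mult_div_cancel[symmetric])
  thus thesis by (rule that)
qed

lemma truncate_fps_Suc:
  "truncate_fps (Suc L) f = pCons (fps_nth f 0) (truncate_fps L (fps_shift 1 f))"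
  by (rule poly_eqI) (auto simp: coeff_pCons coeff_truncate_fps split: nat.splits)

text \<open>Writing f = s + x f', the series f' is a root of Q(x, s + xy), and remains one after a
  power of x is cancelled. The recursion thus reads off f one coefficient at a time.\<close>

lemma truncate_in_rational_factors:
  assumes "Q \<noteq> 0" "eval_fps2 Q f = 0"
  shows "truncate_fps L f \<in> rational_factors L Q"
  using assms
proof (induction L arbitrary: Q f)
  case (Suc L)
  define s where "s = fps_nth f 0"
  define R where "R = pcompose Q [:[:s:], [:0, 1:]:]"
  have "R \<noteq> 0" using Suc.prems by (simp add: R_def pcompose_eq_0_iff)
  have f: "f = fps_const s + fps_shift 1 f * fps_X"
    by (rule fps_ext) (simp add: s_def)
  have "eval_fps2 R (fps_shift 1 f) = eval_fps2 Q f"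
    by (subst (2) f) (simp add: R_def eval_fps2_pcompose fps_of_poly_const)
  hence R0: "eval_fps2 R (fps_shift 1 f) = 0" using Suc.prems by simp
  obtain a where a: "R = [:monom 1 a:] * strip_x R" using strip_x_eq[OF \<open>R \<noteq> 0\<close>] .
  have "strip_x R \<noteq> 0" using a \<open>R \<noteq> 0\<close> by auto
  moreover have "eval_fps2 (strip_x R) (fps_shift 1 f) = 0"
    using R0 by (subst (asm) a) (simp add: eval_fps2_smult fps_of_poly_monom)
  ultimately have "truncate_fps L (fps_shift 1 f) \<in> rational_factors L (factor_step s Q)"
    using Suc.IH by (simp add: factor_step_def R_def)
  moreover have "poly (map_poly (\<lambda>p. poly p 0) Q) s = 0"
    using Suc.prems(2) by (metis fps_nth_eval_fps2_0 fps_zero_nth s_def)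
  ultimately show ?case by (auto simp: truncate_fps_Suc s_def)
qed auto

subsection \<open>Interpolation\<close>

text \<open>This is \<open>lam^P\<close> Q(x, b/lam), with the denominators cleared.\<close>

definition homogenize :: "nat \<Rightarrow> 'a::field poly poly \<Rightarrow> 'a poly \<Rightarrow> 'a poly \<Rightarrow> 'a poly" where
  "homogenize P Q b lam = (\<Sum>v\<le>P. coeff Q v * b ^ v * lam ^ (P - v))"

lemma fps_of_poly_homogenize:
  assumes "degree Q \<le> P" and f: "fps_of_poly lam * f = fps_of_poly b"
  shows "fps_of_poly (homogenize P Q b lam) = fps_of_poly lam ^ P * eval_fps2 Q f"
proof -
  have "fps_of_poly lam ^ P = fps_of_poly lam ^ v * fps_of_poly lam ^ (P - v)" if "v \<le> P" for v
    using that by (simp flip: power_add)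
  hence "fps_of_poly (coeff Q v * b ^ v * lam ^ (P - v)) =
      fps_of_poly lam ^ P * (fps_of_poly (coeff Q v) * f ^ v)" if "v \<le> P" for v
    using that by (simp add: fps_of_poly_mult fps_of_poly_power power_mult_distrib mult_ac flip: f)
  thus ?thesis
    unfolding homogenize_def eval_fps2_altdef[OF assms(1)] fps_of_poly_sum sum_distrib_left
    by (intro sum.cong) auto
qed

lemma pcompose_power: "pcompose (p ^ k) q = pcompose p q ^ k" for p :: "'a::comm_ring_1 poly"
  by (induction k) (simp_all add: pcompose_mult pcompose_1)

lemma linear_power_dvd_of_coeff_eq_0:
  assumes "\<And>u. u < k \<Longrightarrow> coeff (pcompose p [:a, 1:]) u = 0"
  shows "[:- a, 1:] ^ k dvd (p :: 'a::field poly)"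
proof -
  have "monom 1 k dvd pcompose p [:a, 1:]" using assms by (simp add: monom_1_dvd_iff')
  then obtain q where "pcompose p [:a, 1:] = monom 1 k * q" ..
  hence "pcompose (pcompose p [:a, 1:]) [:-a, 1:] = pcompose (monom 1 k * q) [:-a, 1:]" by simp
  also have "pcompose (pcompose p [:a, 1:]) [:-a, 1:] = p"
    by (simp add: pcompose_pCons flip: pcompose_assoc)
  also have "pcompose (monom 1 k * q) [:-a, 1:] = [:-a, 1:] ^ k * pcompose q [:-a, 1:]"
    by (simp add: monom_altdef pcompose_mult pcompose_power pcompose_pCons)
  finally show ?thesis by (metis dvd_triv_left)
qed

text \<open>Expand Q in powers of y - c. In the term of index v, the multiplicity condition gives
  \<open>m - v\<close> factors x - a in the coefficient, and \<open>b - smult c lam\<close> vanishes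
  at \<open>a\<close>, which gives v more. The expansion is compared in power series, where
  \<open>lam\<close> is invertible.\<close>

lemma power_dvd_homogenize:
  assumes "vanishes_at Q a c m" "degree Q \<le> P" "coeff lam 0 = 1"
    and "poly b a = c * poly lam a"
  shows "[:- a, 1:] ^ m dvd homogenize P Q b lam"
proof -
  define Q' where "Q' = pcompose Q [:[:c:], 1:]"
  define f where "f = fps_of_poly b * inverse (fps_of_poly lam)"
  have f: "fps_of_poly lam * f = fps_of_poly b"
    using assms(3) inverse_mult_eq_1'[of "fps_of_poly lam"]
    by (metis f_def fps_of_poly_nth mult.left_commute mult.right_neutral zero_neq_one)
  have degQ': "degree Q' \<le> P"
    using degree_pcompose_le[of Q "[:[:c:], 1:]"] assms(2) by (simp add: Q'_def)
  have "fps_of_poly (homogenize P Q' (b - smult c lam) lam) =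
      fps_of_poly lam ^ P * eval_fps2 Q' (f - fps_const c)"
    by (rule fps_of_poly_homogenize[OF degQ'])
       (simp only: right_diff_distrib f fps_of_poly_diff fps_of_poly_smult mult.commute[of _ "fps_const c"])
  also have "eval_fps2 Q' (f - fps_const c) = eval_fps2 Q f"
    by (simp add: Q'_def eval_fps2_pcompose fps_of_poly_const)
  also have "fps_of_poly lam ^ P * eval_fps2 Q f = fps_of_poly (homogenize P Q b lam)"
    by (rule fps_of_poly_homogenize[OF assms(2) f, symmetric])
  finally have eq: "homogenize P Q b lam = homogenize P Q' (b - smult c lam) lam"
    by (simp add: fps_of_poly_eq_iff)
  have "[:- a, 1:] ^ m dvd coeff Q' v * (b - smult c lam) ^ v * lam ^ (P - v)" for v
  proof -
    have "coeff (taylor_shift a c Q) v = pcompose (coeff Q' v) [:a, 1:]"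
      by (simp add: taylor_shift_def Q'_def coeff_map_poly)
    hence "[:- a, 1:] ^ (m - v) dvd coeff Q' v"
      using assms(1) by (intro linear_power_dvd_of_coeff_eq_0) (metis less_diff_conv vanishes_at_def)
    moreover have "[:- a, 1:] dvd b - smult c lam"
      using assms(4) by (simp flip: poly_eq_0_iff_dvd)
    hence "[:- a, 1:] ^ v dvd (b - smult c lam) ^ v" by (rule dvd_power_same)
    ultimately have "[:- a, 1:] ^ (m - v) * [:- a, 1:] ^ v dvd coeff Q' v * (b - smult c lam) ^ v"
      by (rule mult_dvd_mono)
    \<comment> \<open>For \<open>v > m\<close> the subtraction truncates to 0, but
      \<open>m \<le> (m - v) + v\<close> holds in any case.\<close>
    moreover have "[:- a, 1:] ^ m dvd [:- a, 1:] ^ (m - v) * [:- a, 1:] ^ v"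
      by (simp add: le_imp_power_dvd flip: power_add)
    ultimately show ?thesis by (meson dvd_mult2 dvd_trans)
  qed
  thus ?thesis unfolding eq homogenize_def[of P Q'] by (intro dvd_sum) auto
qed

lemma coeff_y_reversal: "coeff (y_reversal P Q) v = (if v \<le> P then coeff Q (P - v) else 0)"
  by (auto simp: y_reversal_def coeff_sum sum.delta)

lemma homogenize_y_reversal: "homogenize P (y_reversal P Q) lam b = homogenize P Q b lam"
  unfolding homogenize_def
  by (rule sum.reindex_bij_witness[of _ "\<lambda>v. P - v" "\<lambda>v. P - v"]) (auto simp: coeff_y_reversal mult_ac)

text \<open>Reversal in y exchanges numerator and denominator, so this is the case of ordinate 0
  with \<open>lam\<close> as the numerator.\<close>

lemma power_dvd_homogenize_infinity:
  assumes "passes_through P Q (a, None) m" "poly lam a = 0"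
  shows "[:- a, 1:] ^ m dvd homogenize P Q b lam"
proof -
  define R where "R = y_reversal P Q"
  have "[:- a, 1:] ^ m dvd coeff R v * lam ^ v * b ^ (P - v)" for v
  proof -
    have "coeff (taylor_shift a 0 R) v = pcompose (coeff R v) [:a, 1:]"
      by (simp add: taylor_shift_def coeff_map_poly)
    hence "[:- a, 1:] ^ (m - v) dvd coeff R v"
      using assms(1) by (intro linear_power_dvd_of_coeff_eq_0) (metis R_def less_diff_conv passes_through.simps(2) vanishes_at_def)
    moreover have "[:- a, 1:] ^ v dvd lam ^ v"
      using assms(2) by (intro dvd_power_same) (simp flip: poly_eq_0_iff_dvd)
    ultimately have "[:- a, 1:] ^ (m - v) * [:- a, 1:] ^ v dvd coeff R v * lam ^ v"
      by (rule mult_dvd_mono)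
    moreover have "[:- a, 1:] ^ m dvd [:- a, 1:] ^ (m - v) * [:- a, 1:] ^ v"
      by (simp add: le_imp_power_dvd flip: power_add)
    ultimately show ?thesis by (meson dvd_mult2 dvd_trans)
  qed
  thus ?thesis unfolding homogenize_y_reversal[symmetric, of P Q]
    unfolding homogenize_def R_def[symmetric] by (intro dvd_sum) auto
qed

lemma finite_weighted_degrees:
  "finite {2 * int u + w * int v | u v. coeff (coeff Q v) u \<noteq> 0}"
proof (rule finite_subset)
  show "{2 * int u + w * int v | u v. coeff (coeff Q v) u \<noteq> 0} \<subseteq>
     (\<lambda>(v, u). 2 * int u + w * int v) ` (SIGMA v:{..degree Q}. {..degree (coeff Q v)})"
    by (force intro!: le_degree)
qed auto

lemma weighted_degree_ge:
  "coeff (coeff Q v) u \<noteq> 0 \<Longrightarrow> 2 * int u + w * int v \<le> weighted_degree w Q"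
  unfolding weighted_degree_def by (intro Max_ge finite_weighted_degrees) auto

lemma weighted_degree_le:
  assumes "Q \<noteq> 0" "\<And>u v. coeff (coeff Q v) u \<noteq> 0 \<Longrightarrow> 2 * int u + w * int v \<le> W"
  shows "weighted_degree w Q \<le> W"
proof -
  obtain v u where "coeff (coeff Q v) u \<noteq> 0" using assms by (metis leading_coeff_0_iff)
  thus ?thesis unfolding weighted_degree_def using assms(2)
    by (subst Max_le_iff[OF finite_weighted_degrees]) auto
qed

text \<open>A negative weight makes weighted degrees negative, but the y-degree is at most
  \<open>P\<close>, so they are bounded below by \<open>- \<bar>w\<bar> * P\<close>; after this
  shift a least natural number exists.\<close>

lemma minimal_interpolant_exists:
  assumes "interpolates P m pts Q"
  shows "\<exists>Q. minimal_interpolant P m w pts Q"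
proof -
  define f where "f Q = nat (weighted_degree w Q + \<bar>w\<bar> * int P)" for Q :: "'a poly poly"
  have nonneg: "weighted_degree w Q + \<bar>w\<bar> * int P \<ge> 0" if "interpolates P m pts Q" for Q
  proof -
    have "Q \<noteq> 0" and deg: "degree Q \<le> P" using that by (auto simp: interpolates_def)
    then obtain v u where vu: "coeff (coeff Q v) u \<noteq> 0" by (metis leading_coeff_0_iff)
    hence "v \<le> P" using deg by (metis coeff_0 le_degree le_trans)
    have "- \<bar>w\<bar> * int P \<le> - \<bar>w\<bar> * int v" using \<open>v \<le> P\<close> by (simp add: mult_left_mono)
    also have "\<dots> \<le> w * int v" by (intro mult_right_mono) auto
    finally show ?thesis using weighted_degree_ge[OF vu, of w] by simp
  qed
  obtain Q0 where "interpolates P m pts Q0" "\<And>Q. interpolates P m pts Q \<Longrightarrow> f Q0 \<le> f Q"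
    using ex_has_least_nat[of "interpolates P m pts", OF assms, of f] by blast
  moreover from this have "weighted_degree w Q0 \<le> weighted_degree w Q" if "interpolates P m pts Q" for Q
    using that nonneg by (fastforce simp: f_def)
  ultimately show ?thesis by (auto simp: minimal_interpolant_def)
qed

lemma mult_sum_le_degree:
  fixes H :: "'a::field poly"
  assumes "H \<noteq> 0" "\<And>a. a \<in> A \<Longrightarrow> [:- a, 1:] ^ m dvd H" "m > 0"
  shows "m * card A \<le> degree H"
proof -
  have ord: "m \<le> order a H" if "a \<in> A" for a
    using assms that by (auto simp: order_divides)
  have sub: "A \<subseteq> {x. poly H x = 0}" using ord assms(1,3) by (force simp: order_root)
  have "m * card A = (\<Sum>a\<in>A. m)" by simp
  also have "\<dots> \<le> (\<Sum>a\<in>A. order a H)" by (intro sum_mono ord)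
  also have "\<dots> \<le> (\<Sum>a | poly H a = 0. order a H)"
    using sub poly_roots_finite[OF assms(1)] by (intro sum_mono2) auto
  also have "\<dots> \<le> degree H" by (rule sum_order_le_degree[OF assms(1)])
  finally show ?thesis .
qed

text \<open>Twice the degree of a term is at most 2u + v(\<tau> - L') + (P - v)(\<tau> - L), which
  is 2u + (L - L')v + P(\<tau> - L). This is why the weight of y is the difference of the two
  lengths.\<close>

lemma degree_homogenize_le:
  fixes b lam :: "'a::field poly"
  assumes "homogenize P Q b lam \<noteq> 0"
    and lam: "2 * int (degree lam) + L \<le> \<tau>"
    and b: "b \<noteq> 0 \<Longrightarrow> 2 * int (degree b) + L' \<le> \<tau>"
  shows "2 * int (degree (homogenize P Q b lam)) \<le> weighted_degree (L - L') Q + int P * (\<tau> - L)"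
proof -
  let ?j = "degree (homogenize P Q b lam)"
  have "(\<Sum>v\<le>P. coeff (coeff Q v * b ^ v * lam ^ (P - v)) ?j) \<noteq> 0"
    using assms(1) leading_coeff_0_iff[of "homogenize P Q b lam"]
    by (simp add: homogenize_def coeff_sum)
  then obtain v where "v \<le> P" and nz: "coeff (coeff Q v * b ^ v * lam ^ (P - v)) ?j \<noteq> 0"
    by (meson atMost_iff sum.neutral)
  define u where "u = degree (coeff Q v)"
  have "coeff Q v \<noteq> 0" using nz by auto
  have "b ^ v \<noteq> 0" using nz by (metis coeff_0 mult_zero_left mult_zero_right)
  have "2 * int u + (L - L') * int v \<le> weighted_degree (L - L') Q"
    using \<open>coeff Q v \<noteq> 0\<close> by (intro weighted_degree_ge) (simp add: u_def)
  \<comment> \<open>The bound on \<open>b\<close> is available for nonzero \<open>b\<close> only; a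
    nonzero term with \<open>v > 0\<close> guarantees that.\<close>
  moreover have "int v * (2 * int (degree b)) \<le> int v * (\<tau> - L')"
  proof (cases "v = 0")
    case False
    with \<open>b ^ v \<noteq> 0\<close> have "b \<noteq> 0" by (auto simp: zero_power)
    thus ?thesis using b by (intro mult_left_mono) auto
  qed auto
  moreover have "int (P - v) * (2 * int (degree lam)) \<le> int (P - v) * (\<tau> - L)"
    using lam by (intro mult_left_mono) auto
  moreover have "?j \<le> u + v * degree b + (P - v) * degree lam"
  proof -
    have "?j \<le> degree (coeff Q v * b ^ v * lam ^ (P - v))" using nz by (rule le_degree)
    also have "\<dots> \<le> u + degree (b ^ v) + degree (lam ^ (P - v))"
      unfolding u_def by (meson add_right_mono degree_mult_le le_trans)
    also have "\<dots> \<le> u + v * degree b + (P - v) * degree lam"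
      using degree_power_le[of b v] degree_power_le[of lam "P - v"] by (simp add: mult.commute)
    finally show ?thesis .
  qed
  hence "int ?j \<le> int (u + v * degree b + (P - v) * degree lam)"
    by (simp only: of_nat_le_iff)
  hence "2 * int ?j \<le> 2 * int u + int v * (2 * int (degree b)) + int (P - v) * (2 * int (degree lam))"
    unfolding of_nat_add of_nat_mult by linarith
  moreover have "int (P - v) = int P - int v" using \<open>v \<le> P\<close> by simp
  ultimately show ?thesis by (simp add: algebra_simps)
qed

subsection \<open>Existence of an interpolant\<close>

text \<open>Over a finite field, the pigeonhole principle replaces the rank argument.\<close>

lemma homogeneous_system_nontrivial_solution:
  fixes \<phi> :: "('i \<Rightarrow> 'a::{field,finite}) \<Rightarrow> 'k \<Rightarrow> 'a"
  assumes "finite M" "finite K" "card K < card M"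
    and diff: "\<And>f g k. \<phi> (\<lambda>i. f i - g i) k = \<phi> f k - \<phi> g k"
  obtains f where "\<exists>i\<in>M. f i \<noteq> 0" "\<And>k. k \<in> K \<Longrightarrow> \<phi> f k = 0"
proof -
  let ?F = "\<lambda>f. restrict (\<phi> f) K"
  have "CARD('a) > 1"
    using card_mono[of "UNIV :: 'a set" "{0, 1}"] by simp
  moreover have "?F ` (M \<rightarrow>\<^sub>E UNIV) \<subseteq> (K \<rightarrow>\<^sub>E UNIV)" by auto
  hence "card (?F ` (M \<rightarrow>\<^sub>E (UNIV :: 'a set))) \<le> CARD('a) ^ card K"
    using card_mono[OF finite_PiE[OF assms(2)], of "\<lambda>_. UNIV :: 'a set"] assms(2) by (simp add: card_PiE)
  ultimately have "\<not> inj_on ?F (M \<rightarrow>\<^sub>E (UNIV :: 'a set))"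
    using assms(1,3) by (intro pigeonhole) (auto simp: card_PiE intro: le_less_trans)
  then obtain f g where fg: "f \<in> M \<rightarrow>\<^sub>E UNIV" "g \<in> M \<rightarrow>\<^sub>E UNIV" "f \<noteq> g" "?F f = ?F g"
    by (auto simp: inj_on_def)
  then obtain i where "i \<in> M" "f i \<noteq> g i" by (metis PiE_ext)
  moreover have "\<phi> (\<lambda>i. f i - g i) k = 0" if "k \<in> K" for k
    using fun_cong[OF fg(4), of k] that by (simp add: diff)
  ultimately show thesis by (intro that[of "\<lambda>i. f i - g i"]) auto
qed

text \<open>Treats finite and infinite ordinates alike, so that the interpolation conditions become
  linear conditions on \<open>Q\<close>.\<close>

definition taylor_at :: "nat \<Rightarrow> 'a::field poly poly \<Rightarrow> 'a \<times> 'a option \<Rightarrow> 'a poly poly" where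
  "taylor_at P Q pt =
     (case pt of (a, Some c) \<Rightarrow> taylor_shift a c Q | (a, None) \<Rightarrow> taylor_shift a 0 (y_reversal P Q))"

lemma passes_through_iff:
  "passes_through P Q pt m \<longleftrightarrow> (\<forall>u v. u + v < m \<longrightarrow> coeff (coeff (taylor_at P Q pt) v) u = 0)"
  by (cases "(P, Q, pt, m)" rule: passes_through.cases) (simp_all add: taylor_at_def vanishes_at_def)

lemma taylor_shift_diff: "taylor_shift a c (Q - Q') = taylor_shift a c Q - taylor_shift a c Q'"
  by (rule poly_eqI) (simp add: taylor_shift_def coeff_map_poly pcompose_diff)

lemma taylor_at_diff: "taylor_at P (Q - Q') pt = taylor_at P Q pt - taylor_at P Q' pt"
proof -
  have "y_reversal P (Q - Q') = y_reversal P Q - y_reversal P Q'"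
    by (rule poly_eqI) (simp add: coeff_y_reversal)
  thus ?thesis by (simp add: taylor_at_def taylor_shift_diff split: prod.splits option.splits)
qed

text \<open>For odd \<open>w\<close> the parity of \<open>W - w * v\<close> alternates with v, so
  about half of the columns are even.\<close>

lemma sum_parity:
  fixes W w :: int
  assumes "odd w"
  shows "2 * (\<Sum>v\<le>P. of_bool (even (W - w * int v))) =
    int P + of_bool (even W) + of_bool (even (W - w * int P))"
  using assms by (induction P) auto

text \<open>Twice the size of a column is at least W - wv + 1, plus one more if W - wv is even. By
  \<open>sum_parity\<close> this rounding gain adds up to the extra summand \<open>P\<close>.
  Columns with negative bound are empty and only help the inequality.\<close>

lemma card_monomials_ge:
  fixes W w :: int
  assumes "odd w"
  shows "int (P + 1) * (2 * (W + 1) - w * int P) + int P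
    \<le> 4 * int (card (SIGMA v:{..P}. {u. 2 * int u \<le> W - w * int v}))"
proof -
  have set_eq: "{u. 2 * int u \<le> x} = {..<nat (x div 2 + 1)}" for x :: int
    by auto
  have "int P \<le> 2 * (\<Sum>v\<le>P. of_bool (even (W - w * int v)))"
    by (subst sum_parity[OF assms]) auto
  moreover have "2 * (\<Sum>v\<le>P. W - w * int v + 1) = int (P + 1) * (2 * (W + 1) - w * int P)"
    by (induction P) (auto simp: algebra_simps)
  moreover have "(\<Sum>v\<le>P. W - w * int v + 1) + (\<Sum>v\<le>P. of_bool (even (W - w * int v)))
    \<le> (\<Sum>v\<le>P. 2 * int (card {u. 2 * int u \<le> W - w * int v}))"
    unfolding sum.distrib[symmetric] set_eq by (intro sum_mono) (auto elim!: evenE oddE)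
  moreover have "int (card (SIGMA v:{..P}. {u. 2 * int u \<le> W - w * int v})) =
      (\<Sum>v\<le>P. int (card {u. 2 * int u \<le> W - w * int v}))"
    by (subst card_SigmaI) (auto simp: set_eq)
  ultimately show ?thesis by (simp flip: sum_distrib_left)
qed

lemma card_constraints:
  "2 * card (I \<times> (SIGMA v:{..<m}. {..<m - v})) = card I * (m * (m + 1))"
proof -
  have "2 * (\<Sum>v<m. m - v) = m * (m + 1)"
  proof (induction m)
    case (Suc m)
    have "(\<Sum>v<Suc m. Suc m - v) = Suc m + (\<Sum>v<m. m - v)"
      by (subst sum.lessThan_Suc_shift) simp
    thus ?case using Suc by simp
  qed simp
  thus ?thesis by (simp add: card_cartesian_product card_SigmaI)
qed

text \<open>The monomials of bounded weighted degree outnumber the n m (m + 1)/2 linear constraints;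
  \<open>count\<close> is this comparison multiplied by four.\<close>

lemma interpolant_exists:
  fixes pt :: "nat \<Rightarrow> 'a::{field,finite} \<times> 'a option"
  assumes "odd w"
    and count: "int (2 * n * m * (m + 1)) < int (P + 1) * (2 * (W + 1) - w * int P) + int P"
  obtains Q where "interpolates P m (pt ` {..<n}) Q" "weighted_degree w Q \<le> W"
proof -
  define M where "M = (SIGMA v:{..P}. {u. 2 * int u \<le> W - w * int v})"
  define K where "K = {..<n} \<times> (SIGMA v:{..<m}. {..<m - v})"
  define F where "F f = (\<Sum>(v, u)\<in>M. monom (monom (f (v, u)) u) v)" for f :: "nat \<times> nat \<Rightarrow> 'a"
  define \<phi> where "\<phi> f k = (case k of (i, v, u) \<Rightarrow> coeff (coeff (taylor_at P (F f) (pt i)) v) u)" for f k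
  have "{u. 2 * int u \<le> x} = {..<nat (x div 2 + 1)}" for x :: int
    by auto
  hence [simp]: "finite M" by (simp add: M_def)
  have [simp]: "finite K" by (simp add: K_def)
  have "4 * int (card K) = int (2 * n * m * (m + 1))"
    using arg_cong[OF card_constraints[of "{..<n}" m], of "\<lambda>x. 2 * int x"] by (simp add: K_def algebra_simps)
  hence "card K < card M"
    using card_monomials_ge[OF assms(1), of P W] count unfolding M_def by linarith
  have F_diff: "F (\<lambda>i. f i - g i) = F f - F g" for f g
    by (simp add: F_def diff_monom sum_subtractf split_beta flip: diff_monom)
  have \<phi>_diff: "\<phi> (\<lambda>i. f i - g i) k = \<phi> f k - \<phi> g k" for f g k
    by (simp add: \<phi>_def F_diff taylor_at_diff split_beta)
  obtain f where f: "\<exists>i\<in>M. f i \<noteq> 0" "\<And>k. k \<in> K \<Longrightarrow> \<phi> f k = 0"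
    using homogeneous_system_nontrivial_solution[where \<phi> = \<phi>, OF \<open>finite M\<close> \<open>finite K\<close> \<open>card K < card M\<close> \<phi>_diff] by blast
  have coeff_F: "coeff (coeff (F f) v) u = (if (v, u) \<in> M then f (v, u) else 0)" for v u
  proof -
    have "coeff (coeff (F f) v) u = (\<Sum>i\<in>M. if i = (v, u) then f i else 0)"
      by (auto simp: F_def coeff_sum split_beta prod_eq_iff intro!: sum.cong)
    thus ?thesis by simp
  qed
  have nz: "F f \<noteq> 0" using f(1) coeff_F by (metis coeff_0 surj_pair)
  have "degree (F f) \<le> P"
    by (rule degree_le) (auto simp: poly_eq_iff coeff_F M_def)
  moreover have "passes_through P (F f) (pt i) m" if "i < n" for i
    unfolding passes_through_iff
  proof (intro allI impI)
    fix u v :: nat assume "u + v < m"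
    hence "(i, v, u) \<in> K" using that by (auto simp: K_def)
    from f(2)[OF this] show "coeff (coeff (taylor_at P (F f) (pt i)) v) u = 0" by (simp add: \<phi>_def)
  qed
  ultimately have "interpolates P m (pt ` {..<n}) (F f)" using nz by (auto simp: interpolates_def)
  moreover have "weighted_degree w (F f) \<le> W"
    by (rule weighted_degree_le[OF nz]) (auto simp: coeff_F M_def split: if_splits)
  ultimately show thesis by (rule that)
qed

subsection \<open>The decoding radius\<close>

text \<open>With s the square root, the radius condition reads s < n - 2t, and squaring it gives the
  third inequality. That inequality makes the denominator in the choice of \<open>m\<close>
  positive.\<close>

lemma johnson_radius:
  fixes n d t :: nat
  assumes "2 * d \<le> n"
    and "real t < (real n - sqrt (real n * (real n - 2 * real d))) / 2"
  shows "t < d" "2 * t < n" "real n * (real t - real d / 2) < (real t)\<^sup>2"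
proof -
  define s where "s = sqrt (real n * (real n - 2 * real d))"
  have nd: "2 * real d \<le> real n" using assms(1) by linarith
  have s: "s\<^sup>2 = real n * (real n - 2 * real d)" "0 \<le> s"
    using nd by (auto simp: s_def)
  \<comment> \<open>(n - 2d)^2 is at most n(n - 2d).\<close>
  have "real n - 2 * real d \<le> s"
    unfolding s_def by (rule real_le_rsqrt) (use nd in \<open>auto simp: power2_eq_square intro!: mult_right_mono\<close>)
  hence "real t < real d" using assms(2) unfolding s_def[symmetric] by (simp add: field_simps)
  thus "t < d" by simp
  have *: "s < real n - 2 * real t" using assms(2) unfolding s_def[symmetric] by (simp add: field_simps)
  hence "real (2 * t) < real n" using s by simp
  thus "2 * t < n" by (simp only: of_nat_less_iff)
  have "s\<^sup>2 < (real n - 2 * real t)\<^sup>2" using * s by (intro power_strict_mono) auto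
  thus "real n * (real t - real d / 2) < (real t)\<^sup>2"
    unfolding s(1) by (simp add: power2_eq_square algebra_simps)
qed

text \<open>The quotient is at least 1 because (t - t0)(n - t) is nonnegative, which rearranges to
  denominator at most numerator.\<close>

lemma multiplicity_pos:
  fixes n t t\<^sub>0 :: real
  assumes "t\<^sub>0 < t" "t \<le> n" "n * (t - t\<^sub>0) < t\<^sup>2"
  shows "1 \<le> \<lfloor>t * t\<^sub>0 / (t\<^sup>2 - n * (t - t\<^sub>0))\<rfloor>"
proof -
  have "0 \<le> (t - t\<^sub>0) * (n - t)" using assms by simp
  hence "t\<^sup>2 - n * (t - t\<^sub>0) \<le> t * t\<^sub>0" by (simp add: algebra_simps power2_eq_square)
  thus ?thesis using assms(3) by (simp add: le_floor_iff)
qed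

text \<open>As a function of P the right side is a concave parabola with vertex at X - 1/2, where X
  = (tm + 1/4)/(t - t0); hence P, the floor of X, is an integer maximiser. The summand 1/4 in X
  reflects the rounding gain \<open>+ P\<close>.\<close>

lemma constraint_count_less:
  fixes n t t\<^sub>0 :: real and m P :: nat
  assumes "t\<^sub>0 < t" "0 \<le> t\<^sub>0" "n * (t - t\<^sub>0) < t\<^sup>2" "1 \<le> m"
    and m: "m = nat \<lfloor>t * t\<^sub>0 / (t\<^sup>2 - n * (t - t\<^sub>0))\<rfloor>"
    and P: "P = nat \<lfloor>(t * m + 1 / 4) / (t - t\<^sub>0)\<rfloor>"
  shows "2 * n * m * (m + 1) < (P + 1) * (4 * m * t - 2 * P * (t - t\<^sub>0)) + P"
proof -
  define E where "E = t\<^sup>2 - n * (t - t\<^sub>0)"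
  define \<delta> where "\<delta> = t - t\<^sub>0"
  define X where "X = (t * m + 1 / 4) / \<delta>"
  have "E > 0" "\<delta> > 0" using assms by (auto simp: E_def \<delta>_def)
  have "X \<ge> 0" using \<open>\<delta> > 0\<close> assms(1,2) by (simp add: X_def)
  hence PX: "P \<le> X" "X < P + 1" using P by (simp_all add: X_def \<delta>_def) linarith+
  \<comment> \<open>Here the choice of \<open>m\<close> enters.\<close>
  have "t * t\<^sub>0 / E < m + 1" using m unfolding E_def[symmetric] by linarith
  hence mE: "t * t\<^sub>0 < (m + 1) * E" using \<open>E > 0\<close> by (simp add: field_simps)
  have X: "\<delta> * X = t * m + 1 / 4" using \<open>\<delta> > 0\<close> by (simp add: X_def)
  \<comment> \<open>X lies between P and P + 1; this bounds the parabola at P from below by its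
    common value at X and X - 1.\<close>
  have "0 \<le> (X - P) * (P + 1 - X)" using PX by (intro mult_nonneg_nonneg) auto
  hence "\<delta> * 0 \<le> \<delta> * ((X - P) * (P + 1 - X))" using \<open>\<delta> > 0\<close> by (intro mult_left_mono) auto
  hence 1: "X * (\<delta> * X) - \<delta> * X \<le> 2 * P * (\<delta> * X) - \<delta> * P - \<delta> * P\<^sup>2"
    by (simp add: algebra_simps power2_eq_square)
  have "n * m * (m + 1) < 2 * m * t + (X * (\<delta> * X) - \<delta> * X)"
  proof -
    have "\<delta> * (n * m * (m + 1)) = (t\<^sup>2 - E) * m * (m + 1)"
      by (simp add: E_def \<delta>_def algebra_simps)
    also have "\<dots> = t\<^sup>2 * m * (m + 1) - m * ((m + 1) * E)" by (simp add: algebra_simps)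
    also have "\<dots> \<le> t\<^sup>2 * m * (m + 1) - m * (t * t\<^sub>0)"
      using mE by (intro diff_left_mono mult_left_mono) auto
    also have "\<dots> = (t * m)\<^sup>2 + \<delta> * (m * t)"
      by (simp add: \<delta>_def algebra_simps power2_eq_square)
    \<comment> \<open>The difference of the two sides is tm/2 + 1/16 - \<delta>/4, positive because
      \<delta> < 2tm.\<close>
    also have "\<dots> < (t * m + 1 / 4)\<^sup>2 + \<delta> * (m * t - 1 / 4)"
    proof -
      have "t > 0" using assms(1,2) by linarith
      moreover have "t * 1 \<le> t * real m" using assms(1,2,4) by (intro mult_left_mono) auto
      ultimately have "\<delta> < 2 * (t * real m)" using assms(2) unfolding \<delta>_def by linarith
      thus ?thesis by (simp add: power2_eq_square algebra_simps)
    qed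
    also have "\<dots> = \<delta> * (2 * m * t + (X * (\<delta> * X) - \<delta> * X))"
    proof -
      have sq: "(t * m + 1 / 4)\<^sup>2 = \<delta> * (X * (\<delta> * X))" unfolding X[symmetric]
        by (simp add: power2_eq_square algebra_simps)
      have "\<delta> * (2 * m * t + (X * (\<delta> * X) - \<delta> * X)) =
          \<delta> * (2 * m * t) + \<delta> * (X * (\<delta> * X)) - \<delta> * (\<delta> * X)" by (simp add: algebra_simps)
      also have "\<dots> = \<delta> * (2 * m * t) + (t * m + 1 / 4)\<^sup>2 - \<delta> * (t * m + 1 / 4)"
        by (subst sq[symmetric], subst X) (rule refl)
      finally show ?thesis by (simp add: algebra_simps)
    qed
    finally show ?thesis using \<open>\<delta> > 0\<close> by simp
  qed
  also note 1
  finally have "n * m * (m + 1) < 2 * m * t + (2 * P * (\<delta> * X) - \<delta> * P - \<delta> * P\<^sup>2)" by simp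
  from this[unfolded X] show ?thesis
    unfolding \<delta>_def[symmetric] by (simp add: algebra_simps power2_eq_square)
qed

text \<open>Since t < d, twice t - d/2 is less than t. The bound later transfers the degree estimate
  for \<open>t\<close> errors to fewer errors.\<close>

lemma y_degree_bound_ge:
  assumes "t < d" "real d / 2 < real t"
  shows "2 * m \<le> y_degree_bound d t m"
proof -
  have "2 * m * (real t - real d / 2) \<le> t * m + 1 / 4"
    using assms mult_right_mono[of "real t" "real d" "real m"] by (simp add: algebra_simps)
  hence "2 * m \<le> (t * m + 1 / 4) / (real t - real d / 2)" using assms by (simp add: le_divide_eq)
  thus ?thesis by (simp add: y_degree_bound_def le_nat_iff le_floor_iff)
qed

subsection \<open>The key equation in characteristic two\<close>

lemma uminus_eq_self_of_two_eq_0: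
  assumes "(2::'a::ring_1) = 0"
  shows "- (x::'a) = x"
proof -
  have "x + x = 2 * x" by (simp add: mult_2)
  thus ?thesis using assms by (simp add: eq_neg_iff_add_eq_0 neg_eq_iff_add_eq_0)
qed

lemma of_nat_even_eq_0:
  assumes "(2::'a::comm_ring_1) = 0" "even n"
  shows "(of_nat n :: 'a) = 0"
  using assms by (auto elim: evenE)

text \<open>This is p(x^2) with unchanged coefficients; in characteristic two it equals p(x)^2 only
  if all coefficients are 0 or 1.\<close>

abbreviation frob :: "'a::field poly \<Rightarrow> 'a poly" where
  "frob p \<equiv> pcompose p (monom 1 2)"

lemma poly_frob: "poly (frob p) z = poly p (z\<^sup>2)"
  by (simp add: poly_pcompose poly_monom)

lemma pderiv_frob:
  assumes "(2::'a::field) = 0"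
  shows "pderiv (frob (p :: 'a poly)) = 0"
  using assms by (simp add: pderiv_pcompose pderiv_monom)

lemma degree_frob: "degree (frob p) = 2 * degree p"
  by (simp add: degree_pcompose degree_monom_eq)

lemma frob_eq_0_iff: "frob p = 0 \<longleftrightarrow> p = 0"
  by (subst pcompose_eq_0_iff) (simp_all add: degree_monom_eq)

lemma coeff_frob_0: "coeff (frob p) 0 = coeff p 0"
  by (simp add: poly_pcompose poly_monom flip: poly_0_coeff_0)

text \<open>The error term of the key equation p S = - p', which a locator satisfies together with
  the series of its power sums.\<close>

definition defect :: "'a::field fps \<Rightarrow> 'a poly \<Rightarrow> 'a fps" where
  "defect S p = fps_of_poly p * S + fps_of_poly (pderiv p)"

lemma defect_diff: "defect S (p - q) = defect S p - defect S q"
  by (simp add: defect_def pderiv_diff fps_of_poly_diff algebra_simps)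

lemma defect_add: "defect S (p + q) = defect S p + defect S q"
  by (simp add: defect_def pderiv_add fps_of_poly_add algebra_simps)

lemma defect_smult: "defect S (smult c p) = fps_const c * defect S p"
  by (simp add: defect_def pderiv_smult fps_of_poly_smult algebra_simps)

text \<open>Polynomials in x^2 have derivative 0 in characteristic two, so the defect is linear over
  them.\<close>

lemma defect_frob_mult:
  assumes "(2::'a::field) = 0"
  shows "defect S (frob f * p) = fps_of_poly (frob f) * defect S (p :: 'a poly)"
  by (simp add: defect_def pderiv_mult pderiv_frob[OF assms] fps_of_poly_mult algebra_simps)

lemma defect_monom_2_mult:
  assumes "(2::'a::field) = 0"
  shows "defect S (monom 1 2 * p) = fps_X\<^sup>2 * defect S (p :: 'a poly)"
  using defect_frob_mult[OF assms, of S "[:0, 1:]" p]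
  by (simp add: pcompose_pCons fps_of_poly_monom')

text \<open>
  If \<open>S\<close> is the logarithmic derivative of \<open>\<rho>\<close>, then the defect of \<open>p\<close> is
  \<open>(p \<rho>)' / \<rho>\<close>, and a derivative in characteristic two has no odd coefficients. This is why
  the algorithm may skip every other step.
\<close>

lemma defect_dvd_Suc:
  assumes two: "(2::'a::field) = 0"
    and \<rho>: "S * fps_of_poly \<rho> = - fps_of_poly (pderiv \<rho>)" "coeff \<rho> 0 = (1::'a)"
    and "even r" and dvd: "fps_X ^ (r + 1) dvd defect S p"
  shows "fps_X ^ (r + 2) dvd defect S p"
proof -
  have two': "(2 :: 'a poly) = 0" using two by (simp add: numeral_poly)
  have "defect S p * fps_of_poly \<rho> =
      fps_of_poly p * (S * fps_of_poly \<rho>) + fps_of_poly (pderiv p) * fps_of_poly \<rho>"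
    by (simp add: defect_def algebra_simps)
  also have "\<dots> = fps_of_poly (p * - pderiv \<rho> + pderiv p * \<rho>)"
    by (simp add: \<rho>(1) fps_of_poly_simps)
  also have "p * - pderiv \<rho> + pderiv p * \<rho> = pderiv (p * \<rho>)"
    using uminus_eq_self_of_two_eq_0[OF two'] by (simp only: pderiv_mult mult.commute add.commute)
  finally have eq: "defect S p * fps_of_poly \<rho> = fps_of_poly (pderiv (p * \<rho>))" .
  have low: "fps_nth (defect S p) j = 0" if "j \<le> r" for j
    using iffD1[OF fps_X_power_dvd_iff dvd] that by simp
  \<comment> \<open>The defect vanishes up to index \<open>r\<close> and \<rho> has constant term 1,
    so only one product survives.\<close>
  have "fps_nth (defect S p * fps_of_poly \<rho>) (r + 1)
      = (\<Sum>i=0..r + 1. if i = r + 1 then fps_nth (defect S p) (r + 1) else 0)"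
    unfolding fps_mult_nth by (intro sum.cong) (use low \<rho>(2) in \<open>auto simp: le_Suc_eq\<close>)
  hence "fps_nth (defect S p) (r + 1) = fps_nth (defect S p * fps_of_poly \<rho>) (r + 1)"
    by simp
  also have "\<dots> = of_nat (r + 2) * coeff (p * \<rho>) (r + 2)"
    unfolding eq by (simp add: coeff_pderiv)
  also have "\<dots> = 0"
    using of_nat_even_eq_0[OF two, of "r + 2"] \<open>even r\<close> by (simp only: even_add even_numeral mult_zero_left)
  finally have "fps_nth (defect S p) (r + 1) = 0" .
  thus ?thesis
    unfolding fps_X_power_dvd_iff using low by (auto simp: less_Suc_eq)
qed

subsection \<open>The Berlekamp algorithm\<close>

text \<open>
  The polynomials with defect \<open>O(x^r)\<close> form a module over the polynomials in \<open>x^2\<close>, and the state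
  of the algorithm is a basis of it. Since \<open>L + L'\<close> is odd, the leading terms of the two basis
  elements never cancel in a combination.
\<close>

definition berlekamp_basis ::
  "'a::field fps \<Rightarrow> nat \<Rightarrow> 'a poly \<Rightarrow> 'a poly \<Rightarrow> nat \<Rightarrow> nat \<Rightarrow> bool" where
  "berlekamp_basis S r \<Lambda> xxB L L' \<longleftrightarrow>
     degree \<Lambda> = L \<and> degree xxB = L' \<and> L + L' = r + 1 \<and> 1 \<le> L' \<and>
     coeff \<Lambda> 0 = 1 \<and> coeff xxB 0 = 0 \<and>
     fps_X ^ r dvd defect S \<Lambda> \<and> fps_X ^ (r + 1) dvd defect S xxB - fps_X ^ r \<and>
     (\<forall>p. fps_X ^ r dvd defect S p \<longrightarrow> (\<exists>f g. p = frob f * \<Lambda> + frob g * xxB))"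

text \<open>Splitting into even and odd part: 1 and x form the initial basis.\<close>

lemma frob_decomposition:
  fixes p :: "'a::field poly"
  shows "\<exists>f g. p = frob f + frob g * [:0, 1:]"
proof (induction p)
  case (pCons a p)
  then obtain f g where "p = frob f + frob g * [:0, 1:]" by blast
  hence "pCons a p = [:a:] + [:0, 1:] * (frob f + frob g * [:0, 1:])" by simp
  also have "\<dots> = frob ([:a:] + [:0, 1:] * g) + frob f * [:0, 1:]"
    by (simp add: pcompose_add pcompose_mult pcompose_pCons monom_altdef power2_eq_square algebra_simps)
  finally show ?case by blast
qed (auto intro!: exI[of _ 0])

text \<open>Subtracting \<open>\<Delta>\<close> times \<open>xxB\<close> clears the coefficient at
  \<open>r\<close>, and the one at \<open>r + 1\<close> then vanishes by
  \<open>defect_dvd_Suc\<close>. A multiplication by x^2 raises the order of the other basis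
  element, and a normalised \<open>\<Lambda>\<close> takes the place of \<open>xxB\<close> when the
  lengths are exchanged.\<close>

lemma berlekamp_basis_step:
  fixes S :: "nat \<Rightarrow> 'a::field"
  assumes two: "(2::'a) = 0"
    and \<rho>: "Abs_fps S * fps_of_poly \<rho> = - fps_of_poly (pderiv \<rho>)" "coeff \<rho> 0 = (1::'a)"
    and "even r" and inv: "berlekamp_basis (Abs_fps S) r \<Lambda> xxB L L'"
    and step: "berlekamp_step S r (\<Lambda>, xxB, L, L') = (\<Lambda>1, xxB1, L1, L1')"
  shows "berlekamp_basis (Abs_fps S) (r + 2) \<Lambda>1 xxB1 L1 L1'"
proof -
  let ?D = "defect (Abs_fps S)"
  from inv have deg: "degree \<Lambda> = L" "degree xxB = L'" "L + L' = r + 1" "1 \<le> L'"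
    and coeff0: "coeff \<Lambda> 0 = 1" "coeff xxB 0 = 0"
    and D\<Lambda>: "fps_X ^ r dvd ?D \<Lambda>" and Dx: "fps_X ^ (r + 1) dvd ?D xxB - fps_X ^ r"
    and gen: "\<And>p. fps_X ^ r dvd ?D p \<Longrightarrow> \<exists>f g. p = frob f * \<Lambda> + frob g * xxB"
    by (auto simp: berlekamp_basis_def)
  define \<Delta> where "\<Delta> = (\<Sum>i\<le>L. coeff \<Lambda> i * S (r - i))"
  define \<Lambda>' where "\<Lambda>' = \<Lambda> - smult \<Delta> xxB"
  have st: "(if \<Delta> \<noteq> 0 \<and> 2 * L \<le> r
        then (\<Lambda>', monom 1 2 * smult (inverse \<Delta>) \<Lambda>, L', L + 2)
        else (\<Lambda>', monom 1 2 * xxB, L, L' + 2)) = (\<Lambda>1, xxB1, L1, L1')"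
    using step unfolding berlekamp_step_def \<Delta>_def \<Lambda>'_def Let_def by (simp only: prod.case)
  \<comment> \<open>The derivative contributes nothing at \<open>r\<close>, because
    \<open>L \<le> r\<close>.\<close>
  have \<Delta>: "fps_nth (?D \<Lambda>) r = \<Delta>"
    using fps_nth_mult_le_degree[of \<Lambda> L r "Abs_fps S"] deg
    by (simp add: defect_def coeff_pderiv coeff_eq_0 \<Delta>_def)
  have nthx: "fps_nth (?D xxB) j = (if j = r then 1 else 0)" if "j \<le> r" for j
    using iffD1[OF fps_X_power_dvd_iff Dx] that by auto
  have nth\<Lambda>: "fps_nth (?D \<Lambda>) j = (if j = r then \<Delta> else 0)" if "j \<le> r" for j
    using iffD1[OF fps_X_power_dvd_iff D\<Lambda>] that \<Delta> by auto
  have "fps_X ^ (r + 1) dvd ?D \<Lambda>'"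
    unfolding fps_X_power_dvd_iff by (simp add: \<Lambda>'_def defect_diff defect_smult nthx nth\<Lambda>)
  hence D\<Lambda>': "fps_X ^ (r + 2) dvd ?D \<Lambda>'" by (rule defect_dvd_Suc[OF two \<rho> \<open>even r\<close>])
  have D_shift: "fps_X ^ (r + 2 + 1) dvd ?D (monom 1 2 * p) - fps_X ^ (r + 2)"
    if "\<And>j. j \<le> r \<Longrightarrow> fps_nth (?D p) j = (if j = r then 1 else 0)" for p
  proof -
    have "fps_X ^ (r + 1) dvd ?D p - fps_X ^ r"
      unfolding fps_X_power_dvd_iff using that by simp
    moreover have "?D (monom 1 2 * p) - fps_X ^ (r + 2) = fps_X ^ 2 * (?D p - fps_X ^ r)"
      by (simp add: defect_monom_2_mult[OF two] right_diff_distrib power2_eq_square mult.assoc)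
    moreover have "(fps_X :: 'a fps) ^ (r + 2 + 1) = fps_X ^ 2 * fps_X ^ (r + 1)"
      by (simp add: power2_eq_square)
    ultimately show ?thesis by (metis dvd_refl mult_dvd_mono)
  qed
  have nz: "xxB \<noteq> 0" "\<Lambda> \<noteq> 0" using deg coeff0 by auto
  have \<Lambda>'0: "coeff \<Lambda>' 0 = 1" using coeff0 by (simp add: \<Lambda>'_def)
  have gen': "\<exists>f h. p = frob f * \<Lambda>' + frob h * (monom 1 2 * xxB)" if "fps_X ^ (r + 2) dvd ?D p" for p
  proof -
    have "fps_X ^ r dvd ?D p" "fps_nth (?D p) r = 0"
      using iffD1[OF fps_X_power_dvd_iff that] unfolding fps_X_power_dvd_iff by simp_all
    then obtain f g where p: "p = frob f * \<Lambda> + frob g * xxB" using gen by blast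
    have nth_r: "fps_nth (F * G) r = fps_nth F 0 * fps_nth G r"
      if "\<And>j. j < r \<Longrightarrow> fps_nth G j = 0" for F G :: "'a fps"
    proof -
      have "fps_nth (F * G) r = (\<Sum>i=0..r. if i = 0 then fps_nth F 0 * fps_nth G r else 0)"
        unfolding fps_mult_nth by (intro sum.cong) (use that in auto)
      thus ?thesis by simp
    qed
    have "0 = fps_nth (?D p) r" using \<open>fps_nth (?D p) r = 0\<close> by simp
    \<comment> \<open>The coefficient at \<open>r\<close> sees only the constant terms of
      \<open>f\<close> and \<open>g\<close>. Its vanishing makes \<open>g + smult \<Delta> f\<close>
      divisible by x, which is what the new basis requires.\<close>
    also have "\<dots> = coeff f 0 * \<Delta> + coeff g 0"
      unfolding p defect_add defect_frob_mult[OF two]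
      by (simp add: nth_r nthx nth\<Lambda> coeff_frob_0 del: coeff_pcompose_0)
    finally have "coeff (g + smult \<Delta> f) 0 = 0" by (simp add: mult.commute add.commute)
    then obtain h where "g + smult \<Delta> f = pCons 0 h"
      by (metis coeff_pCons_0 pCons_cases)
    hence g: "g = pCons 0 h - smult \<Delta> f" by (simp add: eq_diff_eq)
    have "p = frob f * \<Lambda>' + frob h * (monom 1 2 * xxB)"
      unfolding p g by (simp add: \<Lambda>'_def pcompose_diff pcompose_smult pcompose_pCons algebra_simps)
    thus ?thesis by blast
  qed
  show ?thesis
  proof (cases "\<Delta> \<noteq> 0 \<and> 2 * L \<le> r")
    case True
    hence eq: "\<Lambda>1 = \<Lambda>'" "xxB1 = monom 1 2 * smult (inverse \<Delta>) \<Lambda>" "L1 = L'" "L1' = L + 2"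
      using st by auto
    \<comment> \<open>\<open>2 * L \<le> r\<close> and \<open>L + L' = r + 1\<close> give
      \<open>L < L'\<close>, so \<open>xxB\<close> determines the degree.\<close>
    have "degree \<Lambda>' = degree (smult \<Delta> xxB)"
      unfolding \<Lambda>'_def diff_conv_add_uminus using True deg
      by (subst degree_add_eq_right) auto
    hence "degree \<Lambda>' = L'" using True deg by simp
    moreover have "degree xxB1 = L + 2"
      unfolding eq using True nz deg by (subst degree_mult_eq) (auto simp: degree_monom_eq)
    moreover have "coeff xxB1 0 = 0" by (simp add: eq coeff_monom_mult)
    moreover have "fps_X ^ (r + 2 + 1) dvd ?D xxB1 - fps_X ^ (r + 2)"
      unfolding eq using True by (intro D_shift) (simp add: defect_smult nth\<Lambda>)
    moreover have "\<exists>f g. p = frob f * \<Lambda>' + frob g * xxB1" if p: "fps_X ^ (r + 2) dvd ?D p" for p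
    proof -
      obtain f h where p: "p = frob f * \<Lambda>' + frob h * (monom 1 2 * xxB)" using gen'[OF p] by blast
      \<comment> \<open>The discarded \<open>xxB\<close> is recovered from the old and the new
        \<open>\<Lambda>\<close>, so \<open>\<Lambda>'\<close> and \<open>xxB1\<close> still
        generate the module.\<close>
      have x: "xxB = smult (inverse \<Delta>) \<Lambda> - smult (inverse \<Delta>) \<Lambda>'"
        using True by (simp add: \<Lambda>'_def smult_diff_right)
      have "monom 1 2 * xxB = xxB1 - smult (inverse \<Delta>) (monom 1 2 * \<Lambda>')"
        unfolding eq by (subst x) (simp add: right_diff_distrib)
      hence h: "frob h * (monom 1 2 * xxB) =
          frob h * xxB1 - smult (inverse \<Delta>) (frob h * (monom 1 2 * \<Lambda>'))"
        by (simp only: right_diff_distrib mult_smult_right)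
      have "p = frob (f - smult (inverse \<Delta>) (pCons 0 h)) * \<Lambda>' + frob h * xxB1"
        unfolding p h by (simp add: pcompose_diff pcompose_smult pcompose_pCons algebra_simps)
      thus ?thesis by blast
    qed
    ultimately show ?thesis unfolding berlekamp_basis_def
      using D\<Lambda>' \<Lambda>'0 deg by (simp add: eq)
  next
    case False
    hence eq: "\<Lambda>1 = \<Lambda>'" "xxB1 = monom 1 2 * xxB" "L1 = L" "L1' = L' + 2"
      using st by (auto split: if_splits)
    have "degree \<Lambda>' = L"
    proof (cases "\<Delta> = 0")
      case False
      \<comment> \<open>\<open>2 * L > r\<close> gives \<open>L' \<le> L\<close>, and equality is
        impossible because \<open>L + L'\<close> is odd.\<close>
      with \<open>\<not> (\<Delta> \<noteq> 0 \<and> 2 * L \<le> r)\<close> deg \<open>even r\<close> have "L' < L" by presburger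
      hence "degree (- smult \<Delta> xxB) < degree \<Lambda>" using deg by simp
      thus ?thesis unfolding \<Lambda>'_def diff_conv_add_uminus using deg
        by (subst degree_add_eq_left) auto
    qed (simp add: \<Lambda>'_def deg)
    moreover have "degree xxB1 = L' + 2"
      unfolding eq using nz deg by (subst degree_mult_eq) (auto simp: degree_monom_eq)
    moreover have "coeff xxB1 0 = 0" by (simp add: eq coeff_monom_mult)
    moreover have "fps_X ^ (r + 2 + 1) dvd ?D xxB1 - fps_X ^ (r + 2)"
      unfolding eq by (intro D_shift nthx)
    ultimately show ?thesis unfolding berlekamp_basis_def
      using D\<Lambda>' \<Lambda>'0 deg gen' by (simp add: eq)
  qed
qed

lemma berlekamp_basis:
  fixes S :: "nat \<Rightarrow> 'a::field"
  assumes two: "(2::'a) = 0"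
    and \<rho>: "Abs_fps S * fps_of_poly \<rho> = - fps_of_poly (pderiv \<rho>)" "coeff \<rho> 0 = (1::'a)"
    and "berlekamp S j = (\<Lambda>, xxB, L, L')"
  shows "berlekamp_basis (Abs_fps S) (2 * j) \<Lambda> xxB L L'"
  using assms(4)
proof (induction j arbitrary: \<Lambda> xxB L L')
  case 0
  have "fps_X dvd defect (Abs_fps S) [:0, 1:] - 1"
    by (simp add: defect_def pderiv_pCons)
  thus ?case using 0 frob_decomposition by (auto simp: berlekamp_basis_def)
next
  case (Suc j)
  obtain \<Lambda>0 xxB0 L0 L0' where st: "berlekamp S j = (\<Lambda>0, xxB0, L0, L0')"
    by (cases "berlekamp S j") auto
  show ?case
    using berlekamp_basis_step[OF two \<rho> _ Suc.IH[OF st], of \<Lambda> xxB L L'] Suc.prems st by simp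
qed

text \<open>The two summands have degrees of different parity when nonzero, so neither can exceed
  the degree of the sum. The constant term of \<open>f\<close> is that of \<sigma> because
  \<open>xxB\<close> vanishes at 0.\<close>

lemma berlekamp_basis_decomposition:
  fixes \<sigma> :: "'a::field poly"
  assumes "berlekamp_basis S r \<Lambda> xxB L L'" "even r" "fps_X ^ r dvd defect S \<sigma>"
  obtains f g where "\<sigma> = frob f * \<Lambda> + frob g * xxB" "coeff f 0 = coeff \<sigma> 0"
    "f \<noteq> 0 \<Longrightarrow> 2 * degree f + L \<le> degree \<sigma>" "g \<noteq> 0 \<Longrightarrow> 2 * degree g + L' \<le> degree \<sigma>"
proof -
  from assms obtain f g where \<sigma>: "\<sigma> = frob f * \<Lambda> + frob g * xxB"
    and deg: "degree \<Lambda> = L" "degree xxB = L'" "L + L' = r + 1" "1 \<le> L'"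
    and coeff0: "coeff \<Lambda> 0 = 1" "coeff xxB 0 = 0"
    by (auto simp: berlekamp_basis_def)
  have nz: "xxB \<noteq> 0" "\<Lambda> \<noteq> 0" using deg coeff0 by auto
  have df: "degree (frob f * \<Lambda>) = 2 * degree f + L" if "f \<noteq> 0"
    using that nz deg by (subst degree_mult_eq) (auto simp: degree_frob frob_eq_0_iff)
  have dg: "degree (frob g * xxB) = 2 * degree g + L'" if "g \<noteq> 0"
    using that nz deg by (subst degree_mult_eq) (auto simp: degree_frob frob_eq_0_iff)
  show thesis
  proof (rule that[OF \<sigma>])
    show "coeff f 0 = coeff \<sigma> 0"
      using coeff0 by (simp add: \<sigma> coeff_mult_0 coeff_frob_0 del: coeff_pcompose_0)
    have "2 * degree f + L \<noteq> 2 * degree g + L'" using deg(3) \<open>even r\<close> by presburger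
    then consider "f = 0 \<or> g = 0" | "f \<noteq> 0" "g \<noteq> 0" "2 * degree f + L < 2 * degree g + L'"
      | "f \<noteq> 0" "g \<noteq> 0" "2 * degree g + L' < 2 * degree f + L"
      by linarith
    hence *: "(f \<noteq> 0 \<longrightarrow> 2 * degree f + L \<le> degree \<sigma>) \<and> (g \<noteq> 0 \<longrightarrow> 2 * degree g + L' \<le> degree \<sigma>)"
    proof cases
      case 1
      thus ?thesis using df dg by (auto simp: \<sigma>)
    next
      case 2
      hence "degree \<sigma> = 2 * degree g + L'" using df dg by (simp add: \<sigma> degree_add_eq_right)
      thus ?thesis using 2 by simp
    next
      case 3
      hence "degree \<sigma> = 2 * degree f + L" using df dg by (simp add: \<sigma> degree_add_eq_left)
      thus ?thesis using 3 by simp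
    qed
    show "2 * degree f + L \<le> degree \<sigma>" if "f \<noteq> 0" using * that by blast
    show "2 * degree g + L' \<le> degree \<sigma>" if "g \<noteq> 0" using * that by blast
  qed
qed

text \<open>For even \<open>r\<close> the monomial x^r has derivative 0, hence lies in the module. A
  common root of the basis would be a root of x^r.\<close>

lemma berlekamp_basis_no_common_root:
  assumes "berlekamp_basis S r \<Lambda> xxB L L'" "even r" "(2::'a::field) = 0" "(z::'a) \<noteq> 0"
    and "poly xxB z = 0"
  shows "poly \<Lambda> z \<noteq> 0"
proof
  assume \<Lambda>z: "poly \<Lambda> z = 0"
  have "pderiv (monom (1::'a) r) = 0"
    using assms(2,3) by (simp add: pderiv_monom of_nat_even_eq_0)
  hence "fps_X ^ r dvd defect S (monom 1 r)"
    by (simp add: defect_def fps_of_poly_monom')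
  then obtain f g where "monom 1 r = frob f * \<Lambda> + frob g * xxB"
    using assms(1) by (auto simp: berlekamp_basis_def)
  hence "z ^ r = poly (frob f * \<Lambda> + frob g * xxB) z"
    by (metis mult.left_neutral poly_monom)
  thus False using assms(4,5) \<Lambda>z by simp
qed

subsection \<open>Reconstructing a rational function from its power series\<close>

text \<open>Beyond index \<open>D\<close> the coefficients of g/f obey the linear recurrence given
  by \<open>f\<close>. Synthesis finds \<open>f\<close> up to a common factor with \<open>g\<close>,
  which coprimality makes constant and the constant term 1 makes trivial.\<close>

lemma lfsr_synthesis_rational:
  fixes f g :: "'a::field poly"
  assumes f0: "coeff f 0 = 1" and F: "fps_of_poly f * F = fps_of_poly g"
    and deg: "degree g \<le> D" "2 * degree f \<le> N"
    and coprime: "\<And>h. h dvd f \<Longrightarrow> h dvd g \<Longrightarrow> degree h = 0"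
  defines "s \<equiv> truncate_fps (D + 1 + N) F"
  shows "lfsr_synthesis (\<lambda>j. coeff s (D + 1 + j)) N = f" "s * f mod monom 1 (D + 1) = g"
proof -
  define U where "U = Abs_fps (\<lambda>j. coeff s (D + 1 + j))"
  define T where "T = truncate_fps (D + 1) F"
  have cut: "fps_cutoff k F = F - fps_X ^ k * fps_shift k F" for k
    by (rule fps_ext) (simp add: fps_X_power_mult_nth)
  have fT: "fps_of_poly (g - f * T) = fps_X ^ (D + 1) * (fps_of_poly f * fps_shift (D + 1) F)"
    by (simp only: fps_of_poly_diff fps_of_poly_mult T_def fps_of_poly_truncate cut
        right_diff_distrib F mult.left_commute) simp
  hence "coeff (g - f * T) j = 0" if "j < D + 1" for j
    using that by (metis dvd_triv_left fps_X_power_dvd_iff fps_of_poly_nth)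
  hence "monom 1 (D + 1) dvd g - f * T" by (simp add: monom_1_dvd_iff')
  then obtain c where c: "g - f * T = monom 1 (D + 1) * c" ..
  have "fps_X ^ (D + 1) * (fps_of_poly f * fps_shift (D + 1) F) = fps_X ^ (D + 1) * fps_of_poly c"
    using fT unfolding c by (simp only: fps_of_poly_mult fps_of_poly_monom')
  hence fc: "fps_of_poly f * fps_shift (D + 1) F = fps_of_poly c"
    by (simp only: mult_cancel_left power_eq_0_iff fps_X_neq_zero simp_thms)
  have "degree T < D + 1" by (simp add: T_def degree_truncate_fps)
  \<comment> \<open>\<open>g\<close> and \<open>T\<close> have degree at most \<open>D\<close>, so
    dividing by \<open>x^(D + 1)\<close> leaves a degree below that of \<open>f\<close>.\<close>
  have "coeff c j = 0" if "j \<ge> degree f" for j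
  proof -
    have "coeff c j = coeff (monom 1 (D + 1) * c) (D + 1 + j)" by (simp add: coeff_monom_mult)
    also have "\<dots> = coeff g (D + 1 + j) - coeff (f * T) (D + 1 + j)" unfolding c[symmetric] by simp
    also have "coeff g (D + 1 + j) = 0" using deg by (intro coeff_eq_0) simp
    also have "coeff (f * T) (D + 1 + j) = 0"
      using degree_mult_le[of f T] \<open>degree T < D + 1\<close> that by (intro coeff_eq_0) simp
    finally show ?thesis by simp
  qed
  moreover have "fps_X ^ N dvd fps_of_poly f * U - fps_of_poly c"
  proof -
    have "fps_X ^ N dvd U - fps_shift (D + 1) F"
      unfolding fps_X_power_dvd_iff by (simp add: U_def s_def add.commute)
    hence "fps_X ^ N dvd fps_of_poly f * (U - fps_shift (D + 1) F)" by (rule dvd_mult)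
    thus ?thesis by (simp only: right_diff_distrib fc)
  qed
  ultimately obtain \<kappa> where \<kappa>: "f = lfsr_synthesis (\<lambda>j. coeff s (D + 1 + j)) N * \<kappa>" "\<kappa> dvd c"
    using lfsr_synthesis_cofactor[OF order_refl f0, of c N] deg(2) unfolding U_def by blast
  \<comment> \<open>The cofactor divides both \<open>f\<close> and \<open>c\<close>, hence also
    \<open>g\<close>.\<close>
  have "g = f * T + monom 1 (D + 1) * c" unfolding c[symmetric] by simp
  hence "\<kappa> dvd g" using \<kappa> by (metis dvd_add dvd_mult dvd_mult2 dvd_triv_right)
  hence "degree \<kappa> = 0" using coprime \<kappa>(1) by (metis dvd_triv_right)
  then obtain k where k: "\<kappa> = [:k:]" by (rule degree_eq_zeroE)
  have "coeff (lfsr_synthesis (\<lambda>j. coeff s (D + 1 + j)) N) 0 = 1"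
    unfolding lfsr_synthesis_def using berlekamp_massey_invariant
    by (metis massey_invariant_def prod_cases5 fst_conv)
  hence "k = 1" using f0 arg_cong[OF \<kappa>(1), of "\<lambda>p. coeff p 0"] k by (simp add: coeff_mult_0)
  thus "lfsr_synthesis (\<lambda>j. coeff s (D + 1 + j)) N = f" using \<kappa>(1) k by simp
  \<comment> \<open>Truncation affects the product only from \<open>x^(D + 1 + N)\<close> on, so the
    remainder modulo \<open>x^(D + 1)\<close> is still \<open>g\<close>.\<close>
  have "fps_of_poly (g - f * s) = fps_X ^ (D + 1 + N) * (fps_of_poly f * fps_shift (D + 1 + N) F)"
    by (simp only: fps_of_poly_diff fps_of_poly_mult s_def fps_of_poly_truncate cut
        right_diff_distrib F mult.left_commute) simp
  hence "coeff (g - f * s) j = 0" if "j < D + 1" for j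
    using that by (metis dvd_triv_left fps_X_power_dvd_iff fps_of_poly_nth trans_less_add1)
  hence "monom 1 (D + 1) dvd g - f * s" by (simp add: monom_1_dvd_iff')
  then obtain q where "g - f * s = monom 1 (D + 1) * q" ..
  hence "g = s * f + q * monom 1 (D + 1)" by (simp add: algebra_simps)
  hence "s * f mod monom 1 (D + 1) = g mod monom 1 (D + 1)" by simp
  also have "\<dots> = g" using deg by (intro mod_poly_less) (simp add: degree_monom_eq)
  finally show "s * f mod monom 1 (D + 1) = g" .
qed

subsection \<open>Error locators\<close>

lemma power2_eq_iff_char_2:
  assumes "(2::'a::field) = 0"
  shows "(x::'a)\<^sup>2 = y\<^sup>2 \<longleftrightarrow> x = y"
  using uminus_eq_self_of_two_eq_0[OF assms, of y] by (auto simp: power2_eq_iff)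

text \<open>Squaring is injective in characteristic two, so g(x^2) has at most
  \<open>degree g\<close> distinct roots although its degree is \<open>2 * degree g\<close>. A
  divisor of a polynomial with as many distinct roots as its degree leaves no room for this
  gap.\<close>

lemma frob_dvd_split_imp_constant:
  fixes p g :: "'a::{field,finite} poly"
  assumes two: "(2::'a) = 0" and "p \<noteq> 0" and card: "card {x. poly p x = 0} = degree p"
    and "frob g dvd p"
  shows "degree g = 0"
proof -
  obtain q where p: "p = frob g * q" using assms(4) ..
  have nz: "g \<noteq> 0" "q \<noteq> 0" using assms(2) p by auto
  have "degree p = 2 * degree g + degree q"
    unfolding p using nz by (subst degree_mult_eq) (auto simp: degree_frob frob_eq_0_iff)
  moreover have "card {x. poly p x = 0} \<le> card {x. poly (frob g) x = 0} + card {x. poly q x = 0}"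
    by (rule order.trans[OF card_mono card_Un_le]) (auto simp: p)
  moreover have "card {x. poly q x = 0} \<le> degree q" using nz by (intro card_poly_roots_bound)
  moreover have "card {x. poly (frob g) x = 0} \<le> card {x. poly g x = 0}"
    by (rule card_inj_on_le[of "\<lambda>x. x\<^sup>2"])
       (auto simp: inj_on_def power2_eq_iff_char_2[OF two] poly_frob)
  moreover have "card {x. poly g x = 0} \<le> degree g" using nz by (intro card_poly_roots_bound)
  ultimately show ?thesis using card by linarith
qed

definition error_locator :: "'a::field \<Rightarrow> nat set \<Rightarrow> 'a poly" where
  "error_locator \<alpha> E = (\<Prod>i\<in>E. [:1, - (\<alpha> ^ i):])"

definition power_sum :: "'a::field \<Rightarrow> nat set \<Rightarrow> nat \<Rightarrow> 'a" where
  "power_sum \<alpha> E j = (\<Sum>i\<in>E. (\<alpha> ^ i) ^ (j + 1))"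

text \<open>Newton's identities: logarithmic derivatives are additive, and the factor 1 - ax
  contributes the geometric series of a/(1 - ax).\<close>

lemma power_sum_error_locator:
  assumes "finite E"
  shows "Abs_fps (power_sum \<alpha> E) * fps_of_poly (error_locator \<alpha> E) = - fps_of_poly (pderiv (error_locator \<alpha> E))"
  using assms
proof (induction E)
  case empty
  show ?case by (simp add: error_locator_def power_sum_def fps_eq_iff)
next
  case (insert k E)
  define a where "a = \<alpha> ^ k"
  define \<sigma> where "\<sigma> = error_locator \<alpha> E"
  define G where "G = Abs_fps (\<lambda>j. a ^ (j + 1))"
  have G: "G * fps_of_poly [:1, - a:] = fps_const a"
  proof (rule fps_ext)
    fix j
    have "G * fps_of_poly [:1, - a:] = G - fps_const a * (G * fps_X)"
      by (simp add: fps_of_poly_linear' algebra_simps flip: fps_const_neg)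
    thus "fps_nth (G * fps_of_poly [:1, - a:]) j = fps_nth (fps_const a) j"
      by (cases j) (simp_all add: G_def)
  qed
  have "Abs_fps (power_sum \<alpha> (insert k E)) = G + Abs_fps (power_sum \<alpha> E)"
    using insert by (simp add: power_sum_def G_def a_def fps_eq_iff)
  moreover have \<sigma>': "error_locator \<alpha> (insert k E) = [:1, - a:] * \<sigma>"
    unfolding error_locator_def \<sigma>_def a_def using insert by (intro prod.insert)
  ultimately have "Abs_fps (power_sum \<alpha> (insert k E)) * fps_of_poly (error_locator \<alpha> (insert k E)) =
      (G * fps_of_poly [:1, - a:]) * fps_of_poly \<sigma>
      + fps_of_poly [:1, - a:] * (Abs_fps (power_sum \<alpha> E) * fps_of_poly \<sigma>)"
    by (simp only: fps_of_poly_mult distrib_right distrib_left mult_ac)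
  also have "\<dots> = - fps_of_poly (pderiv ([:1, - a:] * \<sigma>))"
    using insert.IH unfolding G \<sigma>_def[symmetric]
    by (simp add: pderiv_mult pderiv_pCons fps_of_poly_simps algebra_simps flip: fps_const_neg)
  finally show ?case by (simp only: \<sigma>')
qed

lemma coeff_error_locator_0: "coeff (error_locator \<alpha> E) 0 = 1"
  by (simp add: error_locator_def poly_prod flip: poly_0_coeff_0)

lemma degree_error_locator:
  assumes "\<alpha> \<noteq> 0"
  shows "degree (error_locator \<alpha> E) = card E"
  unfolding error_locator_def using assms by (subst degree_prod_eq_sum_degree) auto

lemma primitive_element_nonzero: "primitive_element \<alpha> \<Longrightarrow> \<alpha> \<noteq> 0"
  by (metis DiffE insertI1 power_one_right primitive_element_def rangeI)

text \<open>A repetition would make the powers periodic with a period below q - 1, too few to cover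
  all nonzero elements.\<close>

lemma primitive_element_inj_on:
  fixes \<alpha> :: "'a::{field,finite}"
  assumes "primitive_element \<alpha>"
  shows "inj_on (\<lambda>i. \<alpha> ^ i) {..<CARD('a) - 1}"
proof (rule linorder_inj_onI')
  fix i j assume ij: "i \<in> {..<CARD('a) - 1}" "j \<in> {..<CARD('a) - 1}" "i < j"
  have nz: "\<alpha> \<noteq> 0" using assms by (rule primitive_element_nonzero)
  show "\<alpha> ^ i \<noteq> \<alpha> ^ j"
  proof
    assume eq: "\<alpha> ^ i = \<alpha> ^ j"
    define p where "p = j - i"
    have "\<alpha> ^ j = \<alpha> ^ i * \<alpha> ^ p" using ij by (simp add: p_def flip: power_add)
    hence p: "\<alpha> ^ p = 1" using eq nz by simp
    have "\<alpha> ^ k = \<alpha> ^ (k mod p)" for k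
    proof -
      have "\<alpha> ^ k = \<alpha> ^ (p * (k div p) + k mod p)" by simp
      thus ?thesis by (simp only: power_add power_mult p power_one mult_1)
    qed
    moreover have "p > 0" using ij by (simp add: p_def)
    ultimately have "range (\<lambda>i. \<alpha> ^ i) \<subseteq> (\<lambda>i. \<alpha> ^ i) ` {..<p}"
      by (metis (no_types, lifting) image_eqI image_subsetI lessThan_iff mod_less_divisor)
    hence "card (UNIV - {0::'a}) \<le> card ((\<lambda>i. \<alpha> ^ i) ` {..<p})"
      using assms by (intro card_mono) (auto simp: primitive_element_def)
    also have "\<dots> \<le> p" using card_image_le[of "{..<p}" "\<lambda>i. \<alpha> ^ i"] by simp
    finally show False using ij by (simp add: p_def card_Diff_singleton)
  qed
qed

text \<open>Translation by 1 permutes the field, so the sum of all elements absorbs q times 1; hence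
  the power \<open>2 ^ e\<close> vanishes, and so does its base.\<close>

lemma two_eq_0_of_card:
  assumes "CARD('a::{field,finite}) = 2 ^ e"
  shows "(2::'a) = 0"
proof -
  have "(\<Sum>x\<in>UNIV. x + 1) = (\<Sum>x\<in>UNIV. x :: 'a)"
    by (rule sum.reindex_bij_witness[of _ "\<lambda>x. x - 1" "\<lambda>x. x + 1"]) auto
  hence "of_nat (2 ^ e) = (0 :: 'a)" by (simp add: sum.distrib flip: assms)
  thus ?thesis by simp
qed

subsection \<open>Words and syndromes\<close>

lemma word_eval_altdef:
  "word_eval R z = (\<Sum>i | coeff R i \<noteq> 0. z ^ i)"
proof -
  have "degree (map_poly of_bit R :: 'a poly) \<le> degree R"
    by (rule degree_le) (simp add: coeff_map_poly coeff_eq_0)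
  hence "word_eval R z = (\<Sum>i\<le>degree R. of_bit (coeff R i) * z ^ i)"
    unfolding word_eval_def poly_altdef
    by (subst sum.mono_neutral_left[of "{..degree R}" "{..degree (map_poly of_bit R)}"])
       (auto simp: coeff_map_poly intro: le_degree dest: coeff_eq_0 simp del: of_bool_eq)
  also have "\<dots> = (\<Sum>i | coeff R i \<noteq> 0. z ^ i)"
    by (rule sum.mono_neutral_cong_right) (auto intro: le_degree)
  finally show ?thesis .
qed

lemma finite_coeff_support: "finite {i. coeff p i \<noteq> 0}"
  by (rule finite_subset[of _ "{..degree p}"]) (auto intro: le_degree)

lemma syndrome_eq_power_sum: "syndrome \<alpha> R = power_sum \<alpha> {i. coeff R i \<noteq> 0}"
proof
  fix j
  have "(\<alpha> ^ (j + 1)) ^ i = (\<alpha> ^ i) ^ (j + 1)" for i by (metis mult.commute power_mult)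
  thus "syndrome \<alpha> R j = power_sum \<alpha> {i. coeff R i \<noteq> 0} j"
    unfolding syndrome_def power_sum_def word_eval_altdef by simp
qed

text \<open>The embedding of bits is additive because 1 + 1 = 0 in the extension field.\<close>

lemma word_eval_add:
  assumes "(2::'a::field) = 0"
  shows "word_eval (R + R') (z::'a) = word_eval R z + word_eval R' z"
proof -
  have "(of_bit (x + y) :: 'a) = of_bit x + of_bit y" for x y :: bit
    using assms by (cases x; cases y) auto
  hence "map_poly of_bit (R + R') = (map_poly of_bit R + map_poly of_bit R' :: 'a poly)"
    by (intro poly_eqI) (simp add: coeff_map_poly del: even_add)
  thus ?thesis by (simp add: word_eval_def)
qed

definition flip_positions :: "bit poly \<Rightarrow> nat set \<Rightarrow> bit poly" where
  "flip_positions R E = R + (\<Sum>i\<in>E. monom 1 i)"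

lemma coeff_flip_positions:
  "finite E \<Longrightarrow> coeff (flip_positions R E) i = coeff R i + of_bool (i \<in> E)"
  by (simp add: flip_positions_def coeff_sum of_bool_def)

lemma hamming_dist_flip_positions: "finite E \<Longrightarrow> hamming_dist (flip_positions R E) R = card E"
proof -
  assume "finite E"
  moreover have "b + of_bool (i \<in> E) \<noteq> b \<longleftrightarrow> i \<in> E" for b :: bit and i by (cases b) auto
  ultimately show ?thesis by (simp only: hamming_dist_def coeff_flip_positions) simp
qed

lemma binary_word_eq_flip_positions:
  assumes "C \<in> binary_words n" "R \<in> binary_words n"
  obtains E where "E \<subseteq> {..<n}" "C = flip_positions R E"
proof -
  let ?E = "{i. coeff C i \<noteq> coeff R i}"
  have sub: "?E \<subseteq> {..<n}"
  proof
    fix i assume "i \<in> ?E"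
    show "i \<in> {..<n}"
    proof (rule ccontr)
      assume "i \<notin> {..<n}"
      hence "coeff C i = 0" "coeff R i = 0"
        using assms by (auto simp: binary_words_def intro!: coeff_eq_0)
      thus False using \<open>i \<in> ?E\<close> by simp
    qed
  qed
  hence "finite ?E" by (rule finite_subset) simp
  have "C = flip_positions R ?E"
  proof (rule poly_eqI)
    fix i show "coeff C i = coeff (flip_positions R ?E) i"
      using \<open>finite ?E\<close> by (cases "coeff C i"; cases "coeff R i") (auto simp: coeff_flip_positions)
  qed
  thus thesis using that sub by blast
qed

lemma flip_positions_in_binary_words:
  assumes "R \<in> binary_words n" "E \<subseteq> {..<n}"
  shows "flip_positions R E \<in> binary_words n"
proof -
  have "finite E" using assms(2) by (rule finite_subset) simp
  moreover have "n > 0" using assms(1) by (auto simp: binary_words_def)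
  ultimately show ?thesis using assms unfolding binary_words_def
    by (auto simp: coeff_flip_positions coeff_eq_0 intro!: degree_lessI)
qed

lemma bch_code_iff_syndrome:
  "C \<in> bch_code \<alpha> n d \<longleftrightarrow> C \<in> binary_words n \<and> (\<forall>j<d - 1. syndrome \<alpha> C j = 0)"
proof -
  have "{1..d - 1} = Suc ` {..<d - 1}" by (simp add: image_Suc_lessThan)
  thus ?thesis by (auto simp: bch_code_def syndrome_def)
qed

subsection \<open>Decoding\<close>

locale decoding =
  fixes \<alpha> :: "'a::{field,finite}" and n d :: nat and R :: "bit poly"
    and \<Lambda> xxB :: "'a poly" and L L' :: nat
  assumes two: "(2::'a) = 0"
    and primitive: "primitive_element \<alpha>"
    and length: "n \<le> CARD('a) - 1"
    and odd: "odd d"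
    and R: "R \<in> binary_words n"
    and berlekamp: "berlekamp (syndrome \<alpha> R) ((d - 1) div 2) = (\<Lambda>, xxB, L, L')"
begin

abbreviation "\<sigma> \<equiv> error_locator \<alpha>"
abbreviation "S \<equiv> Abs_fps (syndrome \<alpha> R)"
abbreviation "z i \<equiv> inverse \<alpha> ^ i"

text \<open>The syndromes of \<open>R\<close> are the power sums of its support, so the locator of
  that support serves as \<rho>.\<close>

lemma basis: "berlekamp_basis S (d - 1) \<Lambda> xxB L L'"
proof -
  have "S * fps_of_poly (\<sigma> {i. coeff R i \<noteq> 0}) = - fps_of_poly (pderiv (\<sigma> {i. coeff R i \<noteq> 0}))"
    unfolding syndrome_eq_power_sum by (rule power_sum_error_locator[OF finite_coeff_support])
  from berlekamp_basis[OF two this coeff_error_locator_0 berlekamp] show ?thesis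
    using odd by simp
qed

lemma lengths: "L + L' = d" "degree \<Lambda> = L" "coeff \<Lambda> 0 = 1" "even (d - 1)"
  using basis odd by (auto simp: berlekamp_basis_def odd_pos)

lemma \<alpha>_nonzero: "\<alpha> \<noteq> 0"
  using primitive by (rule primitive_element_nonzero)

lemma inj_power: "inj_on (\<lambda>i. \<alpha> ^ i) {..<n}"
  using primitive_element_inj_on[OF primitive] length by (auto intro: inj_on_subset)

lemma inj_z: "inj_on z {..<n}"
  using inj_power by (auto simp: inj_on_def power_inverse)

lemma poly_error_locator_eq_0_iff:
  assumes "E \<subseteq> {..<n}" "i < n"
  shows "poly (\<sigma> E) (z i) = 0 \<longleftrightarrow> i \<in> E"
proof -
  have "finite E" using assms(1) by (rule finite_subset) simp
  have "1 - z i * \<alpha> ^ k = 0 \<longleftrightarrow> \<alpha> ^ k = \<alpha> ^ i" for k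
    using \<alpha>_nonzero by (auto simp: power_inverse field_simps)
  hence "poly (\<sigma> E) (z i) = 0 \<longleftrightarrow> (\<exists>k\<in>E. \<alpha> ^ k = \<alpha> ^ i)"
    using \<open>finite E\<close> by (simp add: error_locator_def poly_prod)
  also have "\<dots> \<longleftrightarrow> i \<in> E"
    using inj_power assms by (force simp: inj_on_def)
  finally show ?thesis .
qed

lemma locator_roots_error_locator:
  assumes "E \<subseteq> {..<n}"
  shows "locator_roots \<alpha> n (\<sigma> E) = z ` E" "card (locator_roots \<alpha> n (\<sigma> E)) = card E"
proof -
  show *: "locator_roots \<alpha> n (\<sigma> E) = z ` E"
    using assms poly_error_locator_eq_0_iff[OF assms] by (auto simp: locator_roots_def)
  show "card (locator_roots \<alpha> n (\<sigma> E)) = card E"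
    unfolding * by (intro card_image inj_on_subset[OF inj_z assms])
qed

lemma card_roots_error_locator:
  assumes "E \<subseteq> {..<n}"
  shows "card {x. poly (\<sigma> E) x = 0} = degree (\<sigma> E)"
proof -
  have "\<sigma> E \<noteq> 0" using coeff_error_locator_0[of \<alpha> E] by auto
  have "locator_roots \<alpha> n (\<sigma> E) \<subseteq> {x. poly (\<sigma> E) x = 0}" by (auto simp: locator_roots_def)
  hence "card E \<le> card {x. poly (\<sigma> E) x = 0}"
    using locator_roots_error_locator(2)[OF assms] by (metis card_mono finite)
  thus ?thesis
    using card_poly_roots_bound[OF \<open>\<sigma> E \<noteq> 0\<close>] degree_error_locator[OF \<alpha>_nonzero, of E] by simp
qed

lemma flip_bits_eq: "flip_bits \<alpha> n R p = flip_positions R {i. i < n \<and> poly p (z i) = 0}"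
  by (simp add: flip_bits_def flip_positions_def)

lemma flip_bits_error_locator:
  assumes "E \<subseteq> {..<n}"
  shows "flip_bits \<alpha> n R (\<sigma> E) = flip_positions R E"
proof -
  have "{i. i < n \<and> poly (\<sigma> E) (z i) = 0} = E"
    using assms poly_error_locator_eq_0_iff[OF assms] by auto
  thus ?thesis by (simp add: flip_bits_eq)
qed

text \<open>The defect of the locator is the locator, a unit, times the difference of the syndrome
  series and the power sums of \<open>E\<close>. In characteristic two this difference is the
  syndrome series of the flipped word.\<close>

lemma flip_positions_in_code_iff:
  assumes "E \<subseteq> {..<n}"
  shows "flip_positions R E \<in> bch_code \<alpha> n d \<longleftrightarrow> fps_X ^ (d - 1) dvd defect S (\<sigma> E)"
proof -
  have fin: "finite E" using assms by (rule finite_subset) simp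
  let ?T = "Abs_fps (power_sum \<alpha> E)"
  have "fps_of_poly (pderiv (\<sigma> E)) = - (?T * fps_of_poly (\<sigma> E))"
    unfolding power_sum_error_locator[OF fin] by simp
  hence D: "defect S (\<sigma> E) = fps_of_poly (\<sigma> E) * (S - ?T)"
    unfolding defect_def by (simp add: algebra_simps)
  have unit: "fps_of_poly (\<sigma> E) dvd 1" using coeff_error_locator_0[of \<alpha> E] by simp
  have syn: "syndrome \<alpha> (flip_positions R E) j = syndrome \<alpha> R j + power_sum \<alpha> E j" for j
  proof -
    have "{i. coeff (\<Sum>i\<in>E. monom (1::bit) i) i \<noteq> 0} = E"
      using coeff_flip_positions[OF fin, of 0] by (auto simp: flip_positions_def)
    hence "syndrome \<alpha> (\<Sum>i\<in>E. monom 1 i) j = power_sum \<alpha> E j"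
      by (simp only: syndrome_eq_power_sum)
    thus ?thesis by (simp add: flip_positions_def syndrome_def word_eval_add[OF two])
  qed
  have "a + b = 0 \<longleftrightarrow> a - b = 0" for a b :: 'a
    using uminus_eq_self_of_two_eq_0[OF two, of b] by (metis diff_conv_add_uminus)
  hence "flip_positions R E \<in> bch_code \<alpha> n d \<longleftrightarrow> fps_X ^ (d - 1) dvd S - ?T"
    unfolding bch_code_iff_syndrome fps_X_power_dvd_iff syn
    using flip_positions_in_binary_words[OF R assms] by simp
  thus ?thesis unfolding D using unit by (simp add: dvd_mult_unit_iff' del: fps_is_unit_iff)
qed

lemma codewords_within_radius:
  "{C \<in> bch_code \<alpha> n d. hamming_dist C R \<le> t} =
   flip_positions R ` {E. E \<subseteq> {..<n} \<and> card E \<le> t \<and> fps_X ^ (d - 1) dvd defect S (\<sigma> E)}"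
proof (intro set_eqI iffI)
  fix C assume C: "C \<in> {C \<in> bch_code \<alpha> n d. hamming_dist C R \<le> t}"
  then obtain E where E: "E \<subseteq> {..<n}" "C = flip_positions R E"
    using binary_word_eq_flip_positions[OF _ R, of C] by (auto simp: bch_code_def)
  moreover from E have "finite E" using finite_subset by blast
  ultimately show "C \<in> flip_positions R ` {E. E \<subseteq> {..<n} \<and> card E \<le> t \<and> fps_X ^ (d - 1) dvd defect S (\<sigma> E)}"
    using C flip_positions_in_code_iff hamming_dist_flip_positions by auto
next
  fix C assume "C \<in> flip_positions R ` {E. E \<subseteq> {..<n} \<and> card E \<le> t \<and> fps_X ^ (d - 1) dvd defect S (\<sigma> E)}"
  then obtain E where E: "E \<subseteq> {..<n}" "card E \<le> t" "fps_X ^ (d - 1) dvd defect S (\<sigma> E)"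
    "C = flip_positions R E" by auto
  moreover from E have "finite E" using finite_subset by blast
  ultimately show "C \<in> {C \<in> bch_code \<alpha> n d. hamming_dist C R \<le> t}"
    using flip_positions_in_code_iff hamming_dist_flip_positions by auto
qed

text \<open>Coprimality: a common divisor h of \<open>f\<close> and \<open>g\<close> would make
  h(x^2) divide the locator, whose roots are simple.\<close>

lemma error_locator_decomposition:
  assumes "E \<subseteq> {..<n}" "fps_X ^ (d - 1) dvd defect S (\<sigma> E)"
  obtains f g where "\<sigma> E = frob f * \<Lambda> + frob g * xxB" "coeff f 0 = 1"
    "2 * degree f + L \<le> card E" "g \<noteq> 0 \<longrightarrow> 2 * degree g + L' \<le> card E"
    "\<forall>h. h dvd f \<and> h dvd g \<longrightarrow> degree h = 0"
proof -
  obtain f g where fg: "\<sigma> E = frob f * \<Lambda> + frob g * xxB" "coeff f 0 = 1"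
    "f \<noteq> 0 \<Longrightarrow> 2 * degree f + L \<le> card E" "g \<noteq> 0 \<Longrightarrow> 2 * degree g + L' \<le> card E"
    using berlekamp_basis_decomposition[OF basis lengths(4) assms(2)]
    unfolding coeff_error_locator_0 degree_error_locator[OF \<alpha>_nonzero] by metis
  have "f \<noteq> 0" using fg(2) by auto
  moreover have "degree h = 0" if "h dvd f" "h dvd g" for h
  proof (rule frob_dvd_split_imp_constant[OF two])
    show "\<sigma> E \<noteq> 0" using coeff_error_locator_0[of \<alpha> E] by auto
    show "card {x. poly (\<sigma> E) x = 0} = degree (\<sigma> E)" by (rule card_roots_error_locator[OF assms(1)])
    have "frob h dvd frob p" if "h dvd p" for p
      using that by (metis dvd_def pcompose_mult)
    hence "frob h dvd frob f" "frob h dvd frob g" using that by blast+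
    thus "frob h dvd \<sigma> E" unfolding fg(1) by (intro dvd_add dvd_mult2)
  qed
  ultimately show thesis using fg by (intro that[of f g]) auto
qed

text \<open>A nonzero \<open>g\<close> would force degree at least \<open>L'\<close>, beyond
  \<open>t\<close>. With \<open>g = 0\<close>, \<open>f\<close> divides both coefficients, so it is
  constant and equals 1.\<close>

lemma error_locator_unique:
  assumes "E \<subseteq> {..<n}" "card E \<le> t" "fps_X ^ (d - 1) dvd defect S (\<sigma> E)" "t < L'"
  shows "\<sigma> E = \<Lambda>" "card E = L"
proof -
  obtain f g where fg: "\<sigma> E = frob f * \<Lambda> + frob g * xxB" "coeff f 0 = 1"
    "2 * degree f + L \<le> card E" "g \<noteq> 0 \<longrightarrow> 2 * degree g + L' \<le> card E"
    "\<forall>h. h dvd f \<and> h dvd g \<longrightarrow> degree h = 0"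
    by (rule error_locator_decomposition[OF assms(1,3)])
  have "g = 0" using fg(4) assms(2,4) by (cases "g = 0") simp_all
  hence "degree f = 0" using fg(5) by simp
  then obtain c where "f = [:c:]" by (rule degree_eq_zeroE)
  hence "f = 1" using fg(2) by (simp add: one_pCons)
  thus "\<sigma> E = \<Lambda>" using fg(1) \<open>g = 0\<close> by (simp add: pcompose_1)
  thus "card E = L" using degree_error_locator[OF \<alpha>_nonzero, of E] lengths(2) by simp
qed

text \<open>The two polynomials have degree \<open>L\<close>, share \<open>L\<close> nonzero roots
  and agree at 0; a nonzero difference would have too many roots.\<close>

lemma \<Lambda>_eq_error_locator:
  assumes "card (locator_roots \<alpha> n \<Lambda>) = L"
  defines "E \<equiv> {i. i < n \<and> poly \<Lambda> (z i) = 0}"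
  shows "\<Lambda> = \<sigma> E" "card E = L"
proof -
  have E: "E \<subseteq> {..<n}" by (auto simp: E_def)
  have roots: "locator_roots \<alpha> n \<Lambda> = z ` E" by (auto simp: locator_roots_def E_def)
  show card: "card E = L"
    using assms(1) unfolding roots by (subst (asm) card_image) (auto intro: inj_on_subset[OF inj_z E])
  show "\<Lambda> = \<sigma> E"
  proof (rule ccontr)
    assume neq: "\<Lambda> \<noteq> \<sigma> E"
    have "insert 0 (z ` E) \<subseteq> {x. poly (\<Lambda> - \<sigma> E) x = 0}"
      using poly_error_locator_eq_0_iff[OF E] E lengths(3)
      by (auto simp: E_def coeff_error_locator_0 poly_0_coeff_0)
    hence "card (insert 0 (z ` E)) \<le> card {x. poly (\<Lambda> - \<sigma> E) x = 0}"
      by (intro card_mono) auto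
    also have "\<dots> \<le> degree (\<Lambda> - \<sigma> E)" using neq by (intro card_poly_roots_bound) simp
    also have "\<dots> \<le> L"
      using lengths(2) degree_error_locator[OF \<alpha>_nonzero, of E] card by (intro degree_diff_le) auto
    also have "card (insert 0 (z ` E)) = Suc (card (z ` E))"
      using \<alpha>_nonzero by (intro card_insert_disjoint) auto
    also have "card (z ` E) = L" using assms(1) unfolding roots .
    finally show False by simp
  qed
qed

lemma \<Lambda>_defect: "fps_X ^ (d - 1) dvd defect S \<Lambda>"
  using basis by (simp add: berlekamp_basis_def)

text \<open>Every codeword in the ball has locator \<open>\<Lambda>\<close>. Conversely, if
  \<open>\<Lambda>\<close> has \<open>L\<close> roots among the positions, it is the locator of an
  error set, and its defect condition makes the flipped word a codeword.\<close>

lemma unique_decoding: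
  assumes "L \<le> t" "t < L'"
  shows "(if card (locator_roots \<alpha> n \<Lambda>) = L then {flip_bits \<alpha> n R \<Lambda>} else {}) =
    {C \<in> bch_code \<alpha> n d. hamming_dist C R \<le> t}"
proof (cases "card (locator_roots \<alpha> n \<Lambda>) = L")
  case True
  define E where "E = {i. i < n \<and> poly \<Lambda> (z i) = 0}"
  have E: "E \<subseteq> {..<n}" "\<Lambda> = \<sigma> E" "card E = L"
    using \<Lambda>_eq_error_locator[OF True] by (auto simp: E_def)
  have "E' = E" if E': "E' \<subseteq> {..<n}" "card E' \<le> t" "fps_X ^ (d - 1) dvd defect S (\<sigma> E')" for E'
  proof -
    have "\<sigma> E' = \<sigma> E" using error_locator_unique(1)[OF E' assms(2)] E(2) by simp
    hence "i \<in> E' \<longleftrightarrow> i \<in> E" if "i < n" for i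
      using poly_error_locator_eq_0_iff[OF _ that] E'(1) E(1) by metis
    thus ?thesis using E'(1) E(1) by auto
  qed
  hence "{E. E \<subseteq> {..<n} \<and> card E \<le> t \<and> fps_X ^ (d - 1) dvd defect S (\<sigma> E)} = {E}"
    using E(1,3) assms(1) \<Lambda>_defect[unfolded E(2)] by blast
  thus ?thesis using True flip_bits_error_locator[OF E(1)] E(2) by (simp add: codewords_within_radius)
next
  case False
  have "\<not> card E \<le> t" if "E \<subseteq> {..<n}" "fps_X ^ (d - 1) dvd defect S (\<sigma> E)" for E
  proof
    assume "card E \<le> t"
    from error_locator_unique[OF that(1) this that(2) assms(2)] show False
      using locator_roots_error_locator(2)[OF that(1)] False by simp
  qed
  hence "\<not> (E \<subseteq> {..<n} \<and> card E \<le> t \<and> fps_X ^ (d - 1) dvd defect S (\<sigma> E))" for E by blast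
  thus ?thesis using False by (simp add: codewords_within_radius)
qed

lemma failure:
  assumes "t < L"
  shows "{C \<in> bch_code \<alpha> n d. hamming_dist C R \<le> t} = {}"
proof -
  have "\<not> card E \<le> t" if "E \<subseteq> {..<n}" "fps_X ^ (d - 1) dvd defect S (\<sigma> E)" for E
    by (rule error_locator_decomposition[OF that]) (use assms in simp)
  hence "\<not> (E \<subseteq> {..<n} \<and> card E \<le> t \<and> fps_X ^ (d - 1) dvd defect S (\<sigma> E))" for E by blast
  thus ?thesis by (simp add: codewords_within_radius)
qed

text \<open>The numerator of Q(x, g/f) has a zero of order \<open>m\<close> at each error position;
  the weighted degree bound keeps its degree below \<open>m * card E\<close>, so it
  vanishes.\<close>

lemma interpolant_root:
  fixes t m P :: nat
  assumes Q: "interpolates P m (interpolation_point \<alpha> \<Lambda> xxB ` {..<n}) Q"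
    and wdeg: "weighted_degree (int L - int L') Q < 2 * int m * int t - int P * (int t - int L)"
    and "1 \<le> m" "2 * m \<le> P"
    and E: "E \<subseteq> {..<n}" "card E \<le> t"
    and fg: "\<sigma> E = frob f * \<Lambda> + frob g * xxB" "coeff f 0 = 1"
      "2 * degree f + L \<le> card E" "g \<noteq> 0 \<longrightarrow> 2 * degree g + L' \<le> card E"
  shows "eval_fps2 Q (fps_of_poly g * inverse (fps_of_poly f)) = 0"
proof -
  have degQ: "degree Q \<le> P" using Q by (simp add: interpolates_def)
  have "[:- a, 1:] ^ m dvd homogenize P Q g f" if a: "a \<in> (\<lambda>i. (z i)\<^sup>2) ` E" for a
  proof -
    obtain i where i: "i \<in> E" "a = (z i)\<^sup>2" using a by auto
    hence "i < n" using E(1) by auto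
    have pass: "passes_through P Q (interpolation_point \<alpha> \<Lambda> xxB i) m"
      using Q \<open>i < n\<close> by (auto simp: interpolates_def)
    have "poly (\<sigma> E) (z i) = 0" using poly_error_locator_eq_0_iff[OF E(1) \<open>i < n\<close>] i by simp
    hence root: "poly f a * poly \<Lambda> (z i) + poly g a * poly xxB (z i) = 0"
      unfolding fg(1) i(2) by (simp add: poly_frob)
    show ?thesis
    proof (cases "poly xxB (z i) = 0")
      case True
      \<comment> \<open>At an infinite ordinate the basis has no common root, so the denominator
        \<open>f\<close> must vanish.\<close>
      have "poly \<Lambda> (z i) \<noteq> 0"
        using berlekamp_basis_no_common_root[OF basis lengths(4) two _ True] \<alpha>_nonzero by simp
      hence "poly f a = 0" using root True by simp
      moreover have "passes_through P Q (a, None) m"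
        using pass True i(2) by (simp add: interpolation_point_def Let_def)
      ultimately show ?thesis by (intro power_dvd_homogenize_infinity)
    next
      case False
      define c where "c = - poly \<Lambda> (z i) / poly xxB (z i)"
      have "poly g a * poly xxB (z i) = - (poly f a * poly \<Lambda> (z i))"
        using root by (simp add: eq_neg_iff_add_eq_0 add.commute)
      also have "\<dots> = c * poly f a * poly xxB (z i)"
        using False by (simp add: c_def)
      finally have "poly g a * poly xxB (z i) = c * poly f a * poly xxB (z i)" .
      hence "poly g a = c * poly f a" using False by simp
      moreover have "vanishes_at Q a c m"
        using pass False i(2) by (simp add: interpolation_point_def c_def Let_def)
      ultimately show ?thesis using degQ fg(2) by (intro power_dvd_homogenize)
    qed
  qed
  moreover have "card ((\<lambda>i. (z i)\<^sup>2) ` E) = card E"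
    using inj_on_subset[OF inj_z E(1)]
    by (intro card_image) (auto simp: inj_on_def power2_eq_iff_char_2[OF two])
  ultimately have ge: "homogenize P Q g f = 0 \<or> m * card E \<le> degree (homogenize P Q g f)"
    using mult_sum_le_degree[of "homogenize P Q g f" "(\<lambda>i. (z i)\<^sup>2) ` E" m] \<open>1 \<le> m\<close> by auto
  have less: "degree (homogenize P Q g f) < m * card E" if "homogenize P Q g f \<noteq> 0"
  proof -
    have "2 * int (degree (homogenize P Q g f)) \<le>
        weighted_degree (int L - int L') Q + int P * (int (card E) - int L)"
      using degree_homogenize_le[OF that, of "int L" "int (card E)" "int L'"] fg by force
    \<comment> \<open>\<open>wdeg\<close> is stated for \<open>t\<close> errors; each missing error
      lowers the bound on twice the degree by \<open>P\<close> and the doubled number of zeros by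
      only \<open>2 * m\<close>.\<close>
    moreover have "0 \<le> (int P - 2 * int m) * (int t - int (card E))"
      using \<open>2 * m \<le> P\<close> E(2) by (intro mult_nonneg_nonneg) auto
    ultimately have "2 * int (degree (homogenize P Q g f)) < 2 * int (m * card E)"
      using wdeg by (simp add: algebra_simps)
    thus ?thesis by (simp only: mult_less_cancel_left_pos zero_less_numeral of_nat_less_iff)
  qed
  have H: "homogenize P Q g f = 0"
  proof (rule ccontr)
    assume "homogenize P Q g f \<noteq> 0"
    with ge less show False by auto
  qed
  have unit: "fps_of_poly f * inverse (fps_of_poly f) = 1"
    using fg(2) by (intro inverse_mult_eq_1') simp
  have "fps_of_poly f ^ P * eval_fps2 Q (fps_of_poly g * inverse (fps_of_poly f)) = 0"
    by (subst fps_of_poly_homogenize[OF degQ, of _ _ g, symmetric])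
       (simp_all add: H unit mult.left_commute[of "fps_of_poly f"])
  moreover have "fps_of_poly f \<noteq> 0" using unit by auto
  ultimately show ?thesis by simp
qed

lemma list_decoding:
  fixes t m P :: nat
  assumes "L \<le> t" "L' \<le> t" and Q: "interpolates P m (interpolation_point \<alpha> \<Lambda> xxB ` {..<n}) Q"
    and wdeg: "weighted_degree (int L - int L') Q < 2 * int m * int t - int P * (int t - int L)"
    and m: "1 \<le> m" "2 * m \<le> P"
    and E: "E \<subseteq> {..<n}" "card E \<le> t" "fps_X ^ (d - 1) dvd defect S (\<sigma> E)"
  shows "\<sigma> E \<in> locator_from_series \<Lambda> xxB (t - L') (2 * (t - L)) `
    rational_factors (t - L' + 1 + 2 * (t - L)) Q"
proof -
  obtain f g where fg: "\<sigma> E = frob f * \<Lambda> + frob g * xxB" "coeff f 0 = 1"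
    "2 * degree f + L \<le> card E" "g \<noteq> 0 \<longrightarrow> 2 * degree g + L' \<le> card E"
    "\<forall>h. h dvd f \<and> h dvd g \<longrightarrow> degree h = 0"
    by (rule error_locator_decomposition[OF E(1,3)])
  define F where "F = fps_of_poly g * inverse (fps_of_poly f)"
  define D where "D = t - L'"
  define N where "N = 2 * (t - L)"
  define s where "s = truncate_fps (D + 1 + N) F"
  have "eval_fps2 Q F = 0"
    unfolding F_def by (rule interpolant_root[OF Q wdeg m E(1,2) fg(1-4)])
  moreover have "Q \<noteq> 0" using Q by (simp add: interpolates_def)
  ultimately have s: "s \<in> rational_factors (D + 1 + N) Q"
    unfolding s_def by (intro truncate_in_rational_factors)
  have "fps_of_poly f * F = fps_of_poly g"
    using fg(2) inverse_mult_eq_1'[of "fps_of_poly f"]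
    by (simp add: F_def mult.left_commute[of "fps_of_poly f"])
  moreover have "degree g \<le> D" using fg(4) E(2) by (cases "g = 0") (auto simp: D_def)
  moreover have "2 * degree f \<le> N" using fg(3) E(2) by (simp add: N_def)
  ultimately have "lfsr_synthesis (\<lambda>j. coeff s (D + 1 + j)) N = f" "s * f mod monom 1 (D + 1) = g"
    using lfsr_synthesis_rational[OF fg(2), of F g D N] fg(5) unfolding s_def by blast+
  hence "locator_from_series \<Lambda> xxB D N s = \<sigma> E"
    by (simp only: locator_from_series_def Let_def fg(1))
  from this[symmetric] s show ?thesis unfolding D_def N_def by (rule image_eqI)
qed

end

section \<open>Correctness of the list decoder\<close>

theorem theorem5:
  fixes \<alpha> :: "'a::{field,finite}"
    and n k d t m e :: nat
    and t\<^sub>0 :: real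
    and R :: "bit poly"
  assumes "CARD('a) = 2 ^ e"
    and "primitive_element \<alpha>"
    and "n \<le> CARD('a) - 1"
    and "odd d"
    and "2 * d \<le> n"
    and "k = code_dim (bch_code \<alpha> n d)"
    and "t\<^sub>0 = real d / 2"
    and "t\<^sub>0 < real t"
    and "real t < (real n - sqrt (real n * (real n - 2 * real d))) / 2"
    and "m = nat \<lfloor>real t * t\<^sub>0 / ((real t)\<^sup>2 - real n * (real t - t\<^sub>0))\<rfloor>"
    and "R \<in> binary_words n"
  shows "(\<exists>out. list_decoder_output \<alpha> n d t m R out) \<and>
         (\<forall>out. list_decoder_output \<alpha> n d t m R out \<longrightarrow>
                out = {C \<in> bch_code \<alpha> n d. hamming_dist C R \<le> t})"
proof -
  obtain \<Lambda> xxB L L' where state: "berlekamp (syndrome \<alpha> R) ((d - 1) div 2) = (\<Lambda>, xxB, L, L')"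
    by (cases "berlekamp (syndrome \<alpha> R) ((d - 1) div 2)") auto
  have two: "(2::'a) = 0" using assms(1) by (rule two_eq_0_of_card)
  interpret decoding \<alpha> n d R \<Lambda> xxB L L'
    by (rule decoding.intro) (fact two assms state)+
  let ?codewords = "{C \<in> bch_code \<alpha> n d. hamming_dist C R \<le> t}"
  define P where "P = y_degree_bound d t m"
  \<comment> \<open>The largest integer strictly below the bound required by
    \<open>interpolant_root\<close>.\<close>
  define W where "W = 2 * int m * int t - 1 - int P * (int t - int L)"
  define pt where "pt = interpolation_point \<alpha> \<Lambda> xxB"
  note t = johnson_radius[OF assms(5,9)]
  have t': "real n * (real t - t\<^sub>0) < (real t)\<^sup>2" using t(3) unfolding assms(7) .
  have m: "1 \<le> m"
    using multiplicity_pos[OF assms(8) _ t'] t(2) unfolding assms(10) by linarith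
  have P: "2 * m \<le> P"
    unfolding P_def using t(1) assms(7,8) by (intro y_degree_bound_ge) simp_all
  have "odd (int L - int L')" using lengths(1) assms(4) by auto
  moreover have "int (2 * n * m * (m + 1)) <
      int (P + 1) * (2 * (W + 1) - (int L - int L') * int P) + int P"
  proof -
    have "P = nat \<lfloor>(real t * real m + 1 / 4) / (real t - t\<^sub>0)\<rfloor>"
      unfolding P_def y_degree_bound_def assms(7) ..
    moreover have "0 \<le> t\<^sub>0" using assms(7) by simp
    ultimately have "2 * n * m * (m + 1) < (P + 1) * (4 * m * t - 2 * P * (t - t\<^sub>0)) + P"
      using constraint_count_less[OF assms(8) _ t' m assms(10)] by (simp add: algebra_simps)
    also have "4 * m * t - 2 * P * (t - t\<^sub>0) = of_int (4 * int m * int t - int P * (2 * int t - int d))"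
      by (simp add: assms(7) algebra_simps)
    finally have "real_of_int (int (2 * n * m * (m + 1))) <
        real_of_int (int (P + 1) * (4 * int m * int t - int P * (2 * int t - int d)) + int P)"
      by simp
    \<comment> \<open>The two lengths enter the count only through their sum
      \<open>d\<close>.\<close>
    moreover have "4 * int m * int t - int P * (2 * int t - int d) =
        2 * (W + 1) - (int L - int L') * int P"
      unfolding W_def lengths(1)[symmetric] by (simp add: algebra_simps)
    ultimately show ?thesis by (simp only: of_int_less_iff)
  qed
  ultimately obtain Q0 where Q0: "interpolates P m (pt ` {..<n}) Q0"
    "weighted_degree (int L - int L') Q0 \<le> W" by (rule interpolant_exists)
  consider "t < L" | "L \<le> t" "t < L'" | "L \<le> t" "L' \<le> t" by linarith
  thus ?thesis
  proof cases
    case 1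
    thus ?thesis using failure[OF 1] unfolding list_decoder_output_def state by simp
  next
    case 2
    thus ?thesis using unique_decoding[OF 2] unfolding list_decoder_output_def state by simp
  next
    case 3
    define words where "words Q = {flip_bits \<alpha> n R p | p.
        p \<in> locator_from_series \<Lambda> xxB (t - L') (2 * (t - L)) `
          rational_factors (t - L' + 1 + 2 * (t - L)) Q \<and>
        card (locator_roots \<alpha> n p) = degree p}" for Q
    have output_iff: "list_decoder_output \<alpha> n d t m R out \<longleftrightarrow>
        (\<exists>Q. minimal_interpolant P m (int L - int L') (pt ` {..<n}) Q \<and>
          out = {C \<in> words Q. C \<in> bch_code \<alpha> n d \<and> hamming_dist C R \<le> t})" for out
      using 3 unfolding list_decoder_output_def state words_def P_def pt_def by (simp add: Let_def)
    \<comment> \<open>The last step of the decoder filters by the code and the distance, so one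
      inclusion suffices.\<close>
    have complete: "?codewords \<subseteq> words Q"
      if "minimal_interpolant P m (int L - int L') (pt ` {..<n}) Q" for Q
    proof -
      have Q: "interpolates P m (interpolation_point \<alpha> \<Lambda> xxB ` {..<n}) Q"
        using that by (simp add: minimal_interpolant_def pt_def)
      have "weighted_degree (int L - int L') Q \<le> W"
        using that Q0 by (meson minimal_interpolant_def order_trans)
      hence wdeg: "weighted_degree (int L - int L') Q < 2 * int m * int t - int P * (int t - int L)"
        by (simp add: W_def)
      have "flip_positions R E \<in> words Q"
        if E: "E \<subseteq> {..<n}" "card E \<le> t" "fps_X ^ (d - 1) dvd defect S (\<sigma> E)" for E
      proof -
        have "card (locator_roots \<alpha> n (\<sigma> E)) = degree (\<sigma> E)"
          using locator_roots_error_locator(2)[OF E(1)] degree_error_locator[OF \<alpha>_nonzero] by simp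
        thus ?thesis
          using list_decoding[OF 3 Q wdeg m P E] flip_bits_error_locator[OF E(1)]
          unfolding words_def by (metis (mono_tags, lifting) mem_Collect_eq)
      qed
      thus ?thesis unfolding codewords_within_radius by blast
    qed
    have "list_decoder_output \<alpha> n d t m R out \<longrightarrow> out = ?codewords" for out
      using complete unfolding output_iff by blast
    \<comment> \<open>The output is a relation, so a run has to be exhibited; it comes from a
      minimal interpolant.\<close>
    moreover have "\<exists>out. list_decoder_output \<alpha> n d t m R out"
      using minimal_interpolant_exists[OF Q0(1)] unfolding output_iff by blast
    ultimately show ?thesis by blast
  qed
qed

end
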